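(* Let $Z_{12},Z_{34}$ be real with $|Z_{12}|,|Z_{34}|<2m$, let $\theta_{12},\theta_{34}\in(-\pi/4,\pi/4)$ with $\sin2\theta_{12}=Z_{12}/(2m)$, $\sin2\theta_{34}=Z_{34}/(2m)$, let $\kappa\in\mathbb C$ and $\alpha_1,\alpha_2,\alpha_3,\alpha_4\in\mathbb C$ with $\alpha_1\alpha_3\neq0$, and consider the $\mathcal N=4$ supergravity superamplitude $$\mathcal M=\frac{\kappa}{2m^2}\,x^2\,\big[\alpha_1S^{(1)}_{12}+\alpha_2S^{(2)}_{12}\big]\big[\alpha_3S^{(1)}_{34}+\alpha_4S^{(2)}_{34}\big].$$ Its component with both massive states of spin $2$ and a massless state of helicity $+2$ is $$M(\mathbf 1^{s=2},\mathbf 2^{s=2},P^{+2})=\frac{\kappa}{2m^2}\Big\{g_0\,x^2\langle\mathbf{12}\rangle^4+g_1\,x^2\langle\mathbf{12}\rangle^3\frac{\langle\mathbf 1|P|\mathbf 2]}{m}+g_2\,x^2\langle\mathbf{12}\rangle^2\Big(\frac{\langle\mathbf 1|P|\mathbf 2]}{m}\Big)^2\Big\}$$ with $$g_0=\alpha_1\alpha_3\Big(1-\frac{\alpha_2}{\alpha_1}\frac{Z_{12}}{2m}\Big)\Big(1-\frac{\alpha_4}{\alpha_3}\frac{Z_{34}}{2m}\Big),\quad g_1=\alpha_2\alpha_4\frac{Z_{12}Z_{34}}{2m^2}-\alpha_2\alpha_3\frac{Z_{12}}{2m}-\alpha_1\alpha_4\frac{Z_{34}}{2m},\quad g_2=\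alpha_2\alpha_4\frac{Z_{12}Z_{34}}{4m^2}.$$
   Context: Conventions. All two-valued indices are moved with $\epsilon^{12}=-\epsilon^{21}=1$, $\epsilon_{12}=-\epsilon_{21}=-1$. Repeated indices are summed. For undotted spinors $\lambda_\alpha,\mu_\alpha\in\mathbb C^2$: $\lambda^\alpha=\epsilon^{\alpha\beta}\lambda_\beta$, $\langle\lambda\mu\rangle=\lambda^\alpha\mu_\alpha$. For dotted spinors: $\tilde\mu^{\dot\alpha}=\epsilon^{\dot\alpha\dot\beta}\tilde\mu_{\dot\beta}$, $[\lambda\mu]=\tilde\lambda_{\dot\alpha}\tilde\mu^{\dot\alpha}$. Kinematics (fixed). $m>0$. For $i=1,2$ there are spinors $\lambda^I_{i\alpha},\tilde\lambda^I_{i\dot\alpha}$, $I=1,2$ (written $\mathbf i^I$ inside brackets) with $\langle \mathbf i^I\mathbf i^J\rangle=-m\epsilon^{IJ}$, $[\mathbf i^I\mathbf i^J]=m\epsilon^{IJ}$; $p_{i\alpha\dot\alpha}=\lambda^I_{i\alpha}\epsilon_{IJ}\tilde\lambda^J_{i\dot\alpha}$. There are nonzero spinors $\lambda_{P\alpha},\tilde\lambda_{P\dot\alpha}$ (written $P$ in brackets), $P_{\alpha\dot\alpha}=\lambda_{P\alpha}\tilde\lambda_{P\dot\alpha}$, and $p_1+p_2+P=0$. The nonzero number $x$ is defined by $x\lambda_{P\alpha}=\frac1m p_{1\alpha\dot\alpha}\tilde\lambda_P^{\dot\alpha}$. Also $\langle\mathbf1^I|P|\mathbf2^J]=\langle\mathbf1^IP\rangle[P\mathbf2^J]$.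 Grassmann algebra: complex, on generators $\eta^A_{iI}$ ($i,I\in\{1,2\}$, $A\in\{1,2,3,4\}$) and $\eta^A_P$ ($A\in\{1,2,3,4\}$). Put $\sigma_1=1,\sigma_2=-1$, fix reference spinors with $\langle\zeta P\rangle\ne0$, $[\xi P]\ne0$, and set $$\delta^A=\sum_i\langle P\mathbf i^I\rangle\eta^A_{iI},\quad \mathcal H^A=\frac{1}{\langle\zeta P\rangle}\sum_i\langle\zeta\mathbf i^I\rangle\eta^A_{iI},\quad \bar{\mathcal H}^A=\frac1{[\xi P]}\sum_i[\xi\mathbf i^I]\sigma_i\eta^A_{iI}.$$ For $(a,b)=(1,2)$ or $(3,4)$ put $\bar{\mathcal H}_a=-\bar{\mathcal H}^b$, $\bar{\mathcal H}_b=\bar{\mathcal H}^a$, $c=\cos\theta_{ab}$, $s=\sin\theta_{ab}$, and $$S^{(1)}_{ab}=\big(c\,\eta_P^a\delta^a-\delta^a\mathcal H^a-cs\,\delta^a\bar{\mathcal H}_b\eta_P^a\eta_P^b+s\,\delta^a\mathcal H^a\bar{\mathcal H}_b\eta_P^b\big)\big(c\,\eta_P^b\delta^b-\delta^b\mathcal H^b+cs\,\delta^b\bar{\mathcal H}_a\eta_P^a\eta_P^b+s\,\delta^b\mathcal H^b\bar{\mathcal H}_a\eta_P^a\big),$$ $$S^{(2)}_{ab}=-x\big(c\,\delta^a\mathcal H^a\bar{\mathcal H}_a+\delta^a\eta_P^a\bar{\mathcal H}_a+s\,\delta^a\big)\big(c\,\delta^b\mathcal H^b\bar{\mathcal H}_b+\delta^b\eta_P^b\bar{\mathcal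 H}_b+s\,\delta^b\big).$$ Component: the part of $\mathcal M$ of degree $0$ in $\eta_P$ and of degree exactly one in $\eta_1^A$ and exactly one in $\eta_2^A$ for each $A=1,\dots,4$ is written $C^{I_1I_2I_3I_4,J_1J_2J_3J_4}\prod_{A=1}^4\eta^A_{1I_A}\eta^A_{2J_A}$; $M(\mathbf1^{s=2},\mathbf2^{s=2},P^{+2})$ is the tensor $C$ totally symmetrized in $I_1,\dots,I_4$ and totally symmetrized in $J_1,\dots,J_4$. On the right-hand side of the claim the indices $I$ of $\mathbf 1$ and $J$ of $\mathbf 2$ are suppressed and likewise totally symmetrized with unit weight, e.g. $\langle\mathbf{12}\rangle^4$ stands for the symmetrization of $\prod_{k=1}^4\langle\mathbf1^{I_k}\mathbf2^{J_k}\rangle$. *)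

theory Defs
  imports "HOL-Analysis.Analysis"
begin

section \<open>Grassmann algebras\<close>

text \<open>
  The complex Grassmann algebra on a finite set of generators \<open>'g\<close>. An element is its family
  of coefficients in the basis of monomials, one monomial for every set \<open>S\<close> of generators, its
  factors being written in increasing order of the enumeration \<^const>\<open>to_nat\<close>. The choice of
  this enumeration affects the coordinates but not the algebra.
\<close>

typedef 'g grassmann = "UNIV :: ('g::finite set \<Rightarrow> complex) set"
  morphisms coeff Abs_grassmann ..

setup_lifting type_definition_grassmann

text \<open>The sign needed to sort the concatenation of the ordered monomials of \<open>S\<close> and \<open>T\<close>.\<close>

definition reorder_sign :: "'g::finite set \<Rightarrow> 'g set \<Rightarrow> complex" where
  "reorder_sign S T = (-1) ^ card {(s, t). s \<in> S \<and> t \<in> T \<and> to_nat t < to_nat s}"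

instantiation grassmann :: (finite) "{zero, one, plus, minus, uminus, times}"
begin

lift_definition zero_grassmann :: "'a grassmann" is "\<lambda>_. 0" .

lift_definition one_grassmann :: "'a grassmann" is "\<lambda>S. if S = {} then 1 else 0" .

lift_definition plus_grassmann :: "'a grassmann \<Rightarrow> 'a grassmann \<Rightarrow> 'a grassmann"
  is "\<lambda>f g S. f S + g S" .

lift_definition minus_grassmann :: "'a grassmann \<Rightarrow> 'a grassmann \<Rightarrow> 'a grassmann"
  is "\<lambda>f g S. f S - g S" .

lift_definition uminus_grassmann :: "'a grassmann \<Rightarrow> 'a grassmann"
  is "\<lambda>f S. - f S" .

lift_definition times_grassmann :: "'a grassmann \<Rightarrow> 'a grassmann \<Rightarrow> 'a grassmann"
  is "\<lambda>f g U. \<Sum>S\<in>Pow U. reorder_sign S (U - S) * f S * g (U - S)" .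

instance ..

end

lift_definition gscale :: "complex \<Rightarrow> 'g::finite grassmann \<Rightarrow> 'g grassmann" (infixr \<open>*\<^sub>G\<close> 75)
  is "\<lambda>c f S. c * f S" .

lift_definition gmonom :: "'g::finite set \<Rightarrow> 'g grassmann"
  is "\<lambda>S T. if T = S then 1 else 0" .

definition ggen :: "'g::finite \<Rightarrow> 'g grassmann" where
  "ggen g = gmonom {g}"

lemma reorder_sign_empty [simp]: "reorder_sign {} T = 1" "reorder_sign S {} = 1"
  by (simp_all add: reorder_sign_def)

lemma reorder_sign_Un_left:
  assumes "S \<inter> T = {}"
  shows "reorder_sign (S \<union> T) R = reorder_sign S R * reorder_sign T R"
proof -
  have "{(s, t). s \<in> S \<union> T \<and> t \<in> R \<and> to_nat t < to_nat s} =
      {(s, t). s \<in> S \<and> t \<in> R \<and> to_nat t < to_nat s} \<union>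
      {(s, t). s \<in> T \<and> t \<in> R \<and> to_nat t < to_nat s}" by auto
  moreover have "{(s, t). s \<in> S \<and> t \<in> R \<and> to_nat t < to_nat s} \<inter>
      {(s, t). s \<in> T \<and> t \<in> R \<and> to_nat t < to_nat s} = {}" using assms by auto
  ultimately show ?thesis
    by (simp add: reorder_sign_def card_Un_disjoint power_add)
qed

lemma reorder_sign_Un_right:
  assumes "T \<inter> R = {}"
  shows "reorder_sign S (T \<union> R) = reorder_sign S T * reorder_sign S R"
proof -
  have "{(s, t). s \<in> S \<and> t \<in> T \<union> R \<and> to_nat t < to_nat s} =
      {(s, t). s \<in> S \<and> t \<in> T \<and> to_nat t < to_nat s} \<union>
      {(s, t). s \<in> S \<and> t \<in> R \<and> to_nat t < to_nat s}" by auto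
  moreover have "{(s, t). s \<in> S \<and> t \<in> T \<and> to_nat t < to_nat s} \<inter>
      {(s, t). s \<in> S \<and> t \<in> R \<and> to_nat t < to_nat s} = {}" using assms by auto
  ultimately show ?thesis
    by (simp add: reorder_sign_def card_Un_disjoint power_add)
qed

lemma reorder_sign_pm: "reorder_sign S T = 1 \<or> reorder_sign S T = - 1"
  by (simp add: reorder_sign_def minus_one_power_iff)

lemma grassmann_assoc_coeff:
  fixes f g h :: "'g::finite set \<Rightarrow> complex"
  shows "(\<Sum>V\<in>Pow U. reorder_sign V (U - V) *
            (\<Sum>S\<in>Pow V. reorder_sign S (V - S) * f S * g (V - S)) * h (U - V)) =
         (\<Sum>S\<in>Pow U. reorder_sign S (U - S) * f S *
            (\<Sum>T\<in>Pow (U - S). reorder_sign T (U - S - T) * g T * h (U - S - T)))"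
    (is "?L = ?R")
proof -
  let ?F = "\<lambda>S T. reorder_sign S T * reorder_sign S (U - S - T) * reorder_sign T (U - S - T)
      * f S * g T * h (U - S - T)"
  have "?L = (\<Sum>V\<in>Pow U. \<Sum>S\<in>Pow V. ?F S (V - S))"
  proof (intro sum.cong refl)
    fix V assume V: "V \<in> Pow U"
    show "reorder_sign V (U - V) *
            (\<Sum>S\<in>Pow V. reorder_sign S (V - S) * f S * g (V - S)) * h (U - V) =
          (\<Sum>S\<in>Pow V. ?F S (V - S))"
      unfolding sum_distrib_left sum_distrib_right
    proof (intro sum.cong refl)
      fix S assume S: "S \<in> Pow V"
      have e: "U - S - (V - S) = U - V" using S V by auto
      have "reorder_sign (S \<union> (V - S)) (U - V) =
          reorder_sign S (U - V) * reorder_sign (V - S) (U - V)"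
        by (rule reorder_sign_Un_left) auto
      moreover have "S \<union> (V - S) = V" using S by auto
      ultimately show "reorder_sign V (U - V) * (reorder_sign S (V - S) * f S * g (V - S))
          * h (U - V) = ?F S (V - S)"
        by (simp add: e mult_ac)
    qed
  qed
  also have "\<dots> = (\<Sum>(V, S)\<in>(SIGMA V:Pow U. Pow V). ?F S (V - S))"
    by (simp add: sum.Sigma)
  also have "\<dots> = (\<Sum>(S, T)\<in>(SIGMA S:Pow U. Pow (U - S)). ?F S T)"
    by (rule sum.reindex_bij_witness[where i = "\<lambda>(S, T). (S \<union> T, S)" and j = "\<lambda>(V, S). (S, V - S)"])
       auto
  also have "\<dots> = (\<Sum>S\<in>Pow U. \<Sum>T\<in>Pow (U - S). ?F S T)"
    by (simp add: sum.Sigma)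
  also have "\<dots> = ?R"
    unfolding sum_distrib_left
  proof (intro sum.cong refl)
    fix S T assume "S \<in> Pow U" and T: "T \<in> Pow (U - S)"
    have "reorder_sign S (T \<union> (U - S - T)) = reorder_sign S T * reorder_sign S (U - S - T)"
      by (rule reorder_sign_Un_right) auto
    moreover have "T \<union> (U - S - T) = U - S" using T by auto
    ultimately show "?F S T = reorder_sign S (U - S) * f S *
        (reorder_sign T (U - S - T) * g T * h (U - S - T))"
      by (simp add: mult_ac)
  qed
  finally show ?thesis .
qed

instance grassmann :: (finite) ring_1
proof
  fix a b c :: "'a grassmann"
  show "a + b + c = a + (b + c)" by transfer (simp add: add.assoc)
  show "a + b = b + a" by transfer (simp add: add.commute)
  show "0 + a = a" by transfer simp
  show "- a + a = 0" by transfer simp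
  show "a - b = a + - b" by transfer simp
  show "(0::'a grassmann) \<noteq> 1" by transfer (auto simp: fun_eq_iff)
  show "(a + b) * c = a * c + b * c"
    by transfer (simp add: algebra_simps sum.distrib)
  show "a * (b + c) = a * b + a * c"
    by transfer (simp add: algebra_simps sum.distrib)
  show "1 * a = a"
  proof (transfer, rule ext)
    fix a :: "'a set \<Rightarrow> complex" and U
    have "(\<Sum>S\<in>Pow U. reorder_sign S (U - S) * (if S = {} then 1 else 0) * a (U - S)) =
        (\<Sum>S\<in>Pow U. if S = {} then a U else 0)"
      by (intro sum.cong) auto
    then show "(\<Sum>S\<in>Pow U. reorder_sign S (U - S) * (if S = {} then 1 else 0) * a (U - S)) = a U"
      by simp
  qed
  show "a * 1 = a"
  proof (transfer, rule ext)
    fix a :: "'a set \<Rightarrow> complex" and U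
    have "(\<Sum>S\<in>Pow U. reorder_sign S (U - S) * a S * (if U - S = {} then 1 else 0)) =
        (\<Sum>S\<in>Pow U. if S = U then a U else 0)"
      by (intro sum.cong) auto
    then show "(\<Sum>S\<in>Pow U. reorder_sign S (U - S) * a S * (if U - S = {} then 1 else 0)) = a U"
      by simp
  qed
  show "a * b * c = a * (b * c)"
    by transfer (rule ext, rule grassmann_assoc_coeff)
qed

lemma gscale_simps:
  fixes x y :: "'g::finite grassmann"
  shows "(a + b) *\<^sub>G x = a *\<^sub>G x + b *\<^sub>G x" "a *\<^sub>G (x + y) = a *\<^sub>G x + a *\<^sub>G y"
    "a *\<^sub>G b *\<^sub>G x = (a * b) *\<^sub>G x" "1 *\<^sub>G x = x" "0 *\<^sub>G x = 0" "a *\<^sub>G 0 = (0 :: 'g grassmann)"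
    "(a *\<^sub>G x) * y = a *\<^sub>G (x * y)" "x * (a *\<^sub>G y) = a *\<^sub>G (x * y)"
  by (transfer; force simp: algebra_simps sum_distrib_left intro!: ext sum.cong)+

lemma coeff_sum: "coeff (sum f A) S = (\<Sum>x\<in>A. coeff (f x) S)"
  by (induction A rule: infinite_finite_induct)
     (simp_all add: zero_grassmann.rep_eq plus_grassmann.rep_eq)

lemma gmonom_mult:
  "gmonom S * gmonom T = (if S \<inter> T = {} then reorder_sign S T *\<^sub>G gmonom (S \<union> T) else 0)"
proof (rule coeff_inject[THEN iffD1], rule ext)
  fix U
  have "(\<Sum>V\<in>Pow U. reorder_sign V (U - V) * (if V = S then 1 else 0) * (if U - V = T then 1 else 0))
      = (\<Sum>V\<in>Pow U. if V = S then reorder_sign S (U - S) * (if U - S = T then 1 else 0) else 0)"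
    by (intro sum.cong) auto
  also have "\<dots> = (if S \<subseteq> U then reorder_sign S (U - S) * (if U - S = T then 1 else 0) else 0)"
    by simp
  also have "\<dots> = (if S \<inter> T = {} then reorder_sign S T * (if U = S \<union> T then 1 else 0) else 0)"
  proof -
    have "(S \<subseteq> U \<and> U - S = T) \<longleftrightarrow> (S \<inter> T = {} \<and> U = S \<union> T)" by blast
    then show ?thesis by auto
  qed
  finally show "coeff (gmonom S * gmonom T) U =
      coeff (if S \<inter> T = {} then reorder_sign S T *\<^sub>G gmonom (S \<union> T) else 0) U"
    by (simp add: times_grassmann.rep_eq gmonom.rep_eq gscale.rep_eq zero_grassmann.rep_eq)
qed

lemma ggen_anticomm: "ggen g * ggen h = - (ggen h * ggen g)"
proof (cases "g = h")
  case True
  have "ggen g * ggen g = 0" by (simp add: ggen_def gmonom_mult)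
  then show ?thesis using True by simp
next
  case False
  have "reorder_sign {g} {h} = - reorder_sign {h} {g}"
  proof (cases "to_nat h < to_nat g")
    case True
    then have e: "{(s, t). s \<in> {g} \<and> t \<in> {h} \<and> to_nat t < to_nat s} = {(g, h)}"
      "{(s, t). s \<in> {h} \<and> t \<in> {g} \<and> to_nat t < to_nat s} = {}" by auto
    show ?thesis unfolding reorder_sign_def e by simp
  next
    case nlt: False
    moreover have "to_nat g \<noteq> to_nat h" using False by simp
    ultimately have "to_nat g < to_nat h" by linarith
    then have e: "{(s, t). s \<in> {h} \<and> t \<in> {g} \<and> to_nat t < to_nat s} = {(h, g)}"
      "{(s, t). s \<in> {g} \<and> t \<in> {h} \<and> to_nat t < to_nat s} = {}" by auto
    show ?thesis unfolding reorder_sign_def e by simp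
  qed
  moreover have "(- c) *\<^sub>G x = - (c *\<^sub>G x)" for c and x :: "'a grassmann"
    by transfer simp
  ultimately show ?thesis using False by (simp add: ggen_def gmonom_mult insert_commute)
qed

lemma prod_list_ggen:
  assumes "distinct gs"
  obtains c where "c \<noteq> 0" "prod_list (map ggen gs) = c *\<^sub>G gmonom (set gs)"
proof -
  have "\<exists>c. c \<noteq> 0 \<and> prod_list (map ggen gs) = c *\<^sub>G gmonom (set gs)"
    using assms
  proof (induction gs)
    case Nil
    have "(1 :: 'a grassmann) = gmonom {}" by transfer auto
    then show ?case by (intro exI[of _ 1]) (simp add: gscale_simps)
  next
    case (Cons g gs)
    then obtain c where c: "c \<noteq> 0" "prod_list (map ggen gs) = c *\<^sub>G gmonom (set gs)" by auto
    have "prod_list (map ggen (g # gs)) = (c * reorder_sign {g} (set gs)) *\<^sub>G gmonom (set (g # gs))"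
      using Cons.prems by (simp add: c ggen_def gmonom_mult gscale_simps)
    moreover have "c * reorder_sign {g} (set gs) \<noteq> 0"
      using c(1) reorder_sign_pm[of "{g}" "set gs"] by auto
    ultimately show ?case by blast
  qed
  then show ?thesis using that by blast
qed


section \<open>Spinors\<close>

definition eps_up :: "2 \<Rightarrow> 2 \<Rightarrow> complex" where
  "eps_up a b = (if a = 1 \<and> b = 2 then 1 else if a = 2 \<and> b = 1 then -1 else 0)"

definition eps_down :: "2 \<Rightarrow> 2 \<Rightarrow> complex" where
  "eps_down a b = (if a = 1 \<and> b = 2 then -1 else if a = 2 \<and> b = 1 then 1 else 0)"

text \<open>Spinors, dotted or undotted, are given by their components with lower index.\<close>

definition raise_ix :: "complex^2 \<Rightarrow> complex^2" where
  "raise_ix l = (\<chi> a. \<Sum>b\<in>UNIV. eps_up a b * l $ b)"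

definition angle_br :: "complex^2 \<Rightarrow> complex^2 \<Rightarrow> complex" (\<open>\<langle>_,/ _\<rangle>\<close>) where
  "\<langle>l, k\<rangle> = (\<Sum>a\<in>UNIV. raise_ix l $ a * k $ a)"

definition square_br :: "complex^2 \<Rightarrow> complex^2 \<Rightarrow> complex" (\<open>\<lbrakk>_,/ _\<rbrakk>\<^sub>s\<close>) where
  "\<lbrakk>l, k\<rbrakk>\<^sub>s = (\<Sum>a\<in>UNIV. l $ a * raise_ix k $ a)"

text \<open>
  Momenta as bispinors, the undotted index being the row index: massive, from the spinors
  \<open>\<lambda>\<^sup>I\<close>, \<open>\<lambda>'\<^sup>I\<close> labelled by the little group index \<open>I\<close>, and massless.
\<close>

definition massive_mom :: "(2 \<Rightarrow> complex^2) \<Rightarrow> (2 \<Rightarrow> complex^2) \<Rightarrow> complex^2^2" where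
  "massive_mom l lt = (\<chi> a b. \<Sum>I\<in>UNIV. \<Sum>J\<in>UNIV. l I $ a * eps_down I J * lt J $ b)"

definition massless_mom :: "complex^2 \<Rightarrow> complex^2 \<Rightarrow> complex^2^2" where
  "massless_mom l lt = (\<chi> a b. l $ a * lt $ b)"


section \<open>The on-shell superspace\<close>

text \<open>\<open>Eta i I A\<close> stands for \<open>\<eta>\<^sup>A\<close> of massive leg \<open>i\<close> with lower little group index \<open>I\<close>, and
  \<open>EtaP A\<close> for \<open>\<eta>\<^sup>A\<close> of the massless leg.\<close>

datatype generator = Eta 2 2 4 | EtaP 4

instance generator :: finite
proof
  have "(UNIV :: generator set) \<subseteq> (\<lambda>(i, I, A). Eta i I A) ` UNIV \<union> range EtaP"
  proof
    fix g :: generator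
    show "g \<in> (\<lambda>(i, I, A). Eta i I A) ` UNIV \<union> range EtaP"
      by (cases g) (auto intro: image_eqI[of _ _ "(_, _, _)"])
  qed
  then show "finite (UNIV :: generator set)"
    by (rule finite_subset) simp
qed

abbreviation eta :: "2 \<Rightarrow> 2 \<Rightarrow> 4 \<Rightarrow> generator grassmann" where
  "eta i I A \<equiv> ggen (Eta i I A)"

abbreviation etaP :: "4 \<Rightarrow> generator grassmann" where
  "etaP A \<equiv> ggen (EtaP A)"

text \<open>
  The building blocks of the superamplitude, for given \<open>\<delta>\<^sup>A\<close>, \<open>H\<^sup>A\<close> and conjugate \<open>K\<^sup>A\<close> (with
  upper index). The conjugates with lower index are \<open>K\<^sub>a = - K\<^sup>b\<close> and \<open>K\<^sub>b = K\<^sup>a\<close>.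
\<close>

definition S1 :: "(4 \<Rightarrow> generator grassmann) \<Rightarrow> (4 \<Rightarrow> generator grassmann) \<Rightarrow>
    (4 \<Rightarrow> generator grassmann) \<Rightarrow> real \<Rightarrow> 4 \<Rightarrow> 4 \<Rightarrow> generator grassmann" where
  "S1 \<delta> H K \<theta> a b =
    (let c = complex_of_real (cos \<theta>); s = complex_of_real (sin \<theta>);
         K\<^sub>a = - K b; K\<^sub>b = K a
     in (c *\<^sub>G (etaP a * \<delta> a) - \<delta> a * H a - (c * s) *\<^sub>G (\<delta> a * K\<^sub>b * etaP a * etaP b)
           + s *\<^sub>G (\<delta> a * H a * K\<^sub>b * etaP b))
        * (c *\<^sub>G (etaP b * \<delta> b) - \<delta> b * H b + (c * s) *\<^sub>G (\<delta> b * K\<^sub>a * etaP a * etaP b)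
           + s *\<^sub>G (\<delta> b * H b * K\<^sub>a * etaP a)))"

definition S2 :: "complex \<Rightarrow> (4 \<Rightarrow> generator grassmann) \<Rightarrow> (4 \<Rightarrow> generator grassmann) \<Rightarrow>
    (4 \<Rightarrow> generator grassmann) \<Rightarrow> real \<Rightarrow> 4 \<Rightarrow> 4 \<Rightarrow> generator grassmann" where
  "S2 x \<delta> H K \<theta> a b =
    (let c = complex_of_real (cos \<theta>); s = complex_of_real (sin \<theta>);
         K\<^sub>a = - K b; K\<^sub>b = K a
     in (- x) *\<^sub>G
        ((c *\<^sub>G (\<delta> a * H a * K\<^sub>a) + \<delta> a * etaP a * K\<^sub>a + s *\<^sub>G \<delta> a)
         * (c *\<^sub>G (\<delta> b * H b * K\<^sub>b) + \<delta> b * etaP b * K\<^sub>b + s *\<^sub>G \<delta> b)))"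


section \<open>The component with two massive spin-2 states\<close>

text \<open>Monomials of degree 0 in \<open>\<eta>\<^sub>P\<close> and 1 in each \<open>\<eta>\<^sup>A\<^sub>1\<close> and each \<open>\<eta>\<^sup>A\<^sub>2\<close>.\<close>

definition spin2_degree :: "generator set \<Rightarrow> bool" where
  "spin2_degree S \<longleftrightarrow> card {A. EtaP A \<in> S} = 0 \<and>
     (\<forall>A. card {I. Eta 1 I A \<in> S} = 1 \<and> card {J. Eta 2 J A \<in> S} = 1)"

lift_definition spin2_part :: "generator grassmann \<Rightarrow> generator grassmann"
  is "\<lambda>f S. if spin2_degree S then f S else 0" .

definition spin2_monom :: "(4 \<Rightarrow> 2) \<Rightarrow> (4 \<Rightarrow> 2) \<Rightarrow> generator grassmann" where
  "spin2_monom I J = (\<Prod>A\<leftarrow>[1, 2, 3, 4]. eta 1 (I A) A * eta 2 (J A) A)"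

definition spin2_coeff :: "generator grassmann \<Rightarrow> (4 \<Rightarrow> 2) \<Rightarrow> (4 \<Rightarrow> 2) \<Rightarrow> complex" where
  "spin2_coeff M =
     (THE C. spin2_part M = (\<Sum>I\<in>UNIV. \<Sum>J\<in>UNIV. C I J *\<^sub>G spin2_monom I J))"

text \<open>Symmetrization with unit weight, separately in the indices \<open>I\<close> and in the indices \<open>J\<close>.\<close>

definition symmetrize :: "((4 \<Rightarrow> 2) \<Rightarrow> (4 \<Rightarrow> 2) \<Rightarrow> complex) \<Rightarrow> (4 \<Rightarrow> 2) \<Rightarrow> (4 \<Rightarrow> 2) \<Rightarrow> complex" where
  "symmetrize C I J =
     (\<Sum>\<pi> | \<pi> permutes UNIV. \<Sum>\<rho> | \<rho> permutes UNIV. C (I \<circ> \<pi>) (J \<circ> \<rho>)) / (fact 4)\<^sup>2"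

definition spin2_amplitude :: "generator grassmann \<Rightarrow> (4 \<Rightarrow> 2) \<Rightarrow> (4 \<Rightarrow> 2) \<Rightarrow> complex" where
  "spin2_amplitude M = symmetrize (spin2_coeff M)"

text \<open>The definite description in \<^const>\<open>spin2_coeff\<close> is proper.\<close>

definition spin2_set :: "(4 \<Rightarrow> 2) \<Rightarrow> (4 \<Rightarrow> 2) \<Rightarrow> generator set" where
  "spin2_set I J = (\<Union>A. {Eta 1 (I A) A, Eta 2 (J A) A})"

lemma Eta_in_spin2_set [simp]:
  "Eta 1 K A \<in> spin2_set I J \<longleftrightarrow> K = I A" "Eta 2 K A \<in> spin2_set I J \<longleftrightarrow> K = J A"
  "EtaP A \<notin> spin2_set I J"
  by (auto simp: spin2_set_def)

lemma spin2_degree_iff: "spin2_degree S \<longleftrightarrow> (\<exists>I J. S = spin2_set I J)"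
proof
  assume S: "spin2_degree S"
  then have "\<forall>A. \<exists>K. {K. Eta 1 K A \<in> S} = {K}" "\<forall>A. \<exists>K. {K. Eta 2 K A \<in> S} = {K}"
    by (simp_all add: spin2_degree_def card_1_singleton_iff)
  then obtain I J where IJ: "\<And>A. {K. Eta 1 K A \<in> S} = {I A}" "\<And>A. {K. Eta 2 K A \<in> S} = {J A}"
    by metis
  have "EtaP A \<notin> S" for A using S by (simp add: spin2_degree_def)
  then have "g \<in> S \<longleftrightarrow> g \<in> spin2_set I J" for g
  proof (cases g)
    case (Eta i K A)
    then show ?thesis using IJ[of A] exhaust_2[of i] by (auto simp: set_eq_iff)
  qed auto
  then show "\<exists>I J. S = spin2_set I J" by blast
next
  assume "\<exists>I J. S = spin2_set I J"
  then show "spin2_degree S" by (auto simp: spin2_degree_def)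
qed

lemma spin2_set_inj: "spin2_set I J = spin2_set I' J' \<longleftrightarrow> I = I' \<and> J = J'"
proof
  assume eq: "spin2_set I J = spin2_set I' J'"
  show "I = I' \<and> J = J'"
    using Eta_in_spin2_set(1,2)[of _ _ I J, unfolded eq] by auto
qed simp

lemma spin2_monom_eq:
  obtains c where "c \<noteq> 0" "spin2_monom I J = c *\<^sub>G gmonom (spin2_set I J)"
proof -
  let ?gs = "[Eta 1 (I 1) 1, Eta 2 (J 1) 1, Eta 1 (I 2) 2, Eta 2 (J 2) 2,
    Eta 1 (I 3) 3, Eta 2 (J 3) 3, Eta 1 (I 4) 4, Eta 2 (J 4) 4]"
  have "distinct ?gs" by simp
  moreover have "set ?gs = spin2_set I J"
    by (auto simp: spin2_set_def UNIV_4)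
  moreover have "spin2_monom I J = prod_list (map ggen ?gs)"
    by (simp add: spin2_monom_def mult.assoc)
  ultimately show ?thesis using prod_list_ggen[of ?gs] that by metis
qed

lemma spin2_coeff_ex1:
  "\<exists>!C. spin2_part M = (\<Sum>I\<in>UNIV. \<Sum>J\<in>UNIV. C I J *\<^sub>G spin2_monom I J)"
proof -
  have "\<forall>I J. \<exists>c. c \<noteq> 0 \<and> spin2_monom I J = c *\<^sub>G gmonom (spin2_set I J)"
    using spin2_monom_eq by metis
  then obtain e where e: "\<And>I J. e I J \<noteq> 0"
      "\<And>I J. spin2_monom I J = e I J *\<^sub>G gmonom (spin2_set I J)" by metis
  have coeff_mon: "coeff (spin2_monom I J) S = (if S = spin2_set I J then e I J else 0)" for I J S
    by (simp add: e(2) gscale.rep_eq gmonom.rep_eq)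
  let ?X = "\<lambda>C. \<Sum>I\<in>UNIV. \<Sum>J\<in>UNIV. C I J *\<^sub>G spin2_monom I J"
  have X1: "coeff (?X C) (spin2_set I J) = C I J * e I J" for C I J
  proof -
    have "coeff (?X C) (spin2_set I J) =
        (\<Sum>I'\<in>UNIV. \<Sum>J'\<in>UNIV. if I' = I then (if J' = J then C I J * e I J else 0) else 0)"
      unfolding coeff_sum gscale.rep_eq coeff_mon spin2_set_inj
      by (intro sum.cong refl) auto
    also have "\<dots> = (\<Sum>I'\<in>UNIV. if I' = I then C I J * e I J else 0)"
      by (intro sum.cong refl) simp
    also have "\<dots> = C I J * e I J" by simp
    finally show ?thesis .
  qed
  have X0: "coeff (?X C) S = 0" if "\<not> spin2_degree S" for C S
  proof -
    have "S \<noteq> spin2_set I J" for I J using that spin2_degree_iff by blast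
    then show ?thesis by (simp add: coeff_sum gscale.rep_eq coeff_mon)
  qed
  have iff: "spin2_part M = ?X C \<longleftrightarrow> (\<forall>I J. coeff M (spin2_set I J) = C I J * e I J)" for C
  proof -
    have deg: "spin2_degree (spin2_set I J)" for I J using spin2_degree_iff by blast
    have "spin2_part M = ?X C \<longleftrightarrow> (\<forall>S. coeff (spin2_part M) S = coeff (?X C) S)"
      by (simp only: coeff_inject[symmetric] fun_eq_iff)
    also have "\<dots> \<longleftrightarrow> (\<forall>S. spin2_degree S \<longrightarrow> coeff M S = coeff (?X C) S)"
      using X0 by (auto simp: spin2_part.rep_eq)
    also have "\<dots> \<longleftrightarrow> (\<forall>I J. coeff M (spin2_set I J) = C I J * e I J)"
      using X1 deg by (auto simp: spin2_degree_iff)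
    finally show ?thesis .
  qed
  show ?thesis
  proof (rule ex1I[of _ "\<lambda>I J. coeff M (spin2_set I J) / e I J"])
    show "spin2_part M = ?X (\<lambda>I J. coeff M (spin2_set I J) / e I J)"
      unfolding iff using e(1) by simp
    show "C = (\<lambda>I J. coeff M (spin2_set I J) / e I J)" if "spin2_part M = ?X C" for C
      using that e(1) unfolding iff by (auto simp: fun_eq_iff)
  qed
qed

end

theory Submission
  imports Defs
begin

text \<open>
  Setting \<open>\<eta>\<^sub>P = 0\<close> is an algebra homomorphism, so only the terms free of \<open>\<eta>\<^sub>P\<close> matter; there
  \<open>S\<^sup>(\<^sup>1\<^sup>)\<close> becomes \<open>(\<delta>\<^sup>a H\<^sup>a) (\<delta>\<^sup>b H\<^sup>b)\<close>. The component has degree 2 in each flavour,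
  which leaves of \<open>S\<^sup>(\<^sup>2\<^sup>)\<close> the mixed terms
  \<open>- x c s ((\<delta>\<^sup>a H\<^sup>a) (\<delta>\<^sup>b K\<^sup>b) + (\<delta>\<^sup>a K\<^sup>a) (\<delta>\<^sup>b H\<^sup>b))\<close>, where \<open>K\<close> is the conjugate of \<open>H\<close> and
  \<open>c s = Z / 4m\<close>. The coefficient of \<open>\<eta>\<^sub>1\<^sup>A \<eta>\<^sub>2\<^sup>A\<close> in \<open>\<delta>\<^sup>A H\<^sup>A\<close> is \<open>- \<langle>12\<rangle>\<close> by the Schouten identity.
  Since \<open>[1P] = - x \<langle>1P\<rangle>\<close> and \<open>[2P] = x \<langle>2P\<rangle>\<close>, the one in \<open>x \<delta>\<^sup>A K\<^sup>A\<close> is \<open>- [12]\<close>, again by Schouten,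
  and momentum conservation gives \<open>[12] = \<langle>12\<rangle> + \<langle>1|P|2] / m\<close>. What remains is to multiply out
  the two factors, the order of the four index pairs being irrelevant after symmetrization.
\<close>

section \<open>Gradings of a Grassmann algebra\<close>

lemma grassmann_eqI: "(\<And>S. coeff X S = coeff Y S) \<Longrightarrow> X = Y"
  by (rule coeff_inject[THEN iffD1]) (rule ext)

lemma gscale_minus: "(- c) *\<^sub>G X = - (c *\<^sub>G X)" "c *\<^sub>G (- X) = - (c *\<^sub>G X)"
  by (transfer; simp)+

lemma gscale_diff: "c *\<^sub>G (X - Y) = c *\<^sub>G X - c *\<^sub>G Y"
  by (transfer; force simp: algebra_simps)

lemma gscale_sum: "c *\<^sub>G sum f A = (\<Sum>x\<in>A. c *\<^sub>G f x)"
  by (induction A rule: infinite_finite_induct) (simp_all add: gscale_simps)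

text \<open>Only the generators in \<open>G\<close> are counted, so different choices of
  \<open>G\<close> give different gradings of the same algebra. The proof uses the generators of one
  flavour, and those of one leg and one flavour. Zero is homogeneous of every degree.\<close>

definition homog :: "'g::finite set \<Rightarrow> nat \<Rightarrow> 'g grassmann \<Rightarrow> bool" where
  "homog G n X \<longleftrightarrow> (\<forall>S. coeff X S \<noteq> 0 \<longrightarrow> card (S \<inter> G) = n)"

lemma homog_0 [simp]: "homog G n 0"
  by (simp add: homog_def zero_grassmann.rep_eq)

lemma homog_1: "homog G 0 1"
  by (auto simp: homog_def one_grassmann.rep_eq)

lemma homog_add: "homog G n X \<Longrightarrow> homog G n Y \<Longrightarrow> homog G n (X + Y)"
  unfolding homog_def plus_grassmann.rep_eq by (metis add.left_neutral)

lemma homog_gscale: "homog G n X \<Longrightarrow> homog G n (c *\<^sub>G X)"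
  by (simp add: homog_def gscale.rep_eq)

lemma homog_sum: "(\<And>x. x \<in> A \<Longrightarrow> homog G n (f x)) \<Longrightarrow> homog G n (sum f A)"
  by (induction A rule: infinite_finite_induct) (simp_all add: homog_add)

lemma homog_ggen: "homog G (if g \<in> G then 1 else 0) (ggen g)"
  by (auto simp: homog_def ggen_def gmonom.rep_eq)

lemma homog_mult:
  assumes "homog G n X" "homog G k Y"
  shows "homog G (n + k) (X * Y)"
  unfolding homog_def
proof (intro allI impI)
  fix U assume "coeff (X * Y) U \<noteq> 0"
  then obtain S where S: "S \<in> Pow U"
      "reorder_sign S (U - S) * coeff X S * coeff Y (U - S) \<noteq> 0"
    unfolding times_grassmann.rep_eq by (meson sum.not_neutral_contains_not_neutral)
  then have "card (S \<inter> G) = n" "card ((U - S) \<inter> G) = k"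
    using assms by (auto simp: homog_def)
  moreover have "U \<inter> G = (S \<inter> G) \<union> ((U - S) \<inter> G)" using S by auto
  moreover have "card ((S \<inter> G) \<union> ((U - S) \<inter> G)) = card (S \<inter> G) + card ((U - S) \<inter> G)"
    by (rule card_Un_disjoint) auto
  ultimately show "card (U \<inter> G) = n + k" by simp
qed

text \<open>Unlike the projections on a fixed degree, setting generators to 0 is multiplicative.\<close>

lift_definition kill_gens :: "'g::finite set \<Rightarrow> 'g grassmann \<Rightarrow> 'g grassmann"
  is "\<lambda>G f S. if S \<inter> G = {} then f S else 0" .

lemma kill_gens_linear:
  "kill_gens G (X + Y) = kill_gens G X + kill_gens G Y"
  "kill_gens G (X - Y) = kill_gens G X - kill_gens G Y"
  "kill_gens G (- X) = - kill_gens G X"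
  "kill_gens G (c *\<^sub>G X) = c *\<^sub>G kill_gens G X"
  by (transfer; force)+

lemma kill_gens_ggen: "kill_gens G (ggen g) = (if g \<in> G then 0 else ggen g)"
  by (rule grassmann_eqI)
    (auto simp: kill_gens.rep_eq ggen_def gmonom.rep_eq zero_grassmann.rep_eq)

lemma kill_gens_sum: "kill_gens G (sum f A) = (\<Sum>x\<in>A. kill_gens G (f x))"
proof -
  have "kill_gens G 0 = 0"
    by (rule grassmann_eqI) (simp add: kill_gens.rep_eq zero_grassmann.rep_eq)
  then show ?thesis
    by (induction A rule: infinite_finite_induct) (simp_all add: kill_gens_linear)
qed

lemma kill_gens_mult: "kill_gens G (X * Y) = kill_gens G X * kill_gens G Y"
proof (rule grassmann_eqI)
  fix U
  have "(\<Sum>S\<in>Pow U. reorder_sign S (U - S) * coeff (kill_gens G X) S * coeff (kill_gens G Y) (U - S))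
      = (\<Sum>S\<in>Pow U. if U \<inter> G = {} then reorder_sign S (U - S) * coeff X S * coeff Y (U - S) else 0)"
    by (rule sum.cong) (auto simp: kill_gens.rep_eq)
  then show "coeff (kill_gens G (X * Y)) U = coeff (kill_gens G X * kill_gens G Y) U"
    by (simp add: kill_gens.rep_eq times_grassmann.rep_eq)
qed


section \<open>The spin-2 coefficient as a linear functional\<close>

lemma spin2_part_linear:
  "spin2_part (X + Y) = spin2_part X + spin2_part Y"
  "spin2_part (c *\<^sub>G X) = c *\<^sub>G spin2_part X"
  by (transfer; force)+

lemma spin2_part_coeff:
  "spin2_part X = (\<Sum>I\<in>UNIV. \<Sum>J\<in>UNIV. spin2_coeff X I J *\<^sub>G spin2_monom I J)"
  unfolding spin2_coeff_def by (rule theI'[OF spin2_coeff_ex1])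

lemma spin2_coeff_eqI:
  "spin2_part X = (\<Sum>I\<in>UNIV. \<Sum>J\<in>UNIV. C I J *\<^sub>G spin2_monom I J) \<Longrightarrow> spin2_coeff X = C"
  unfolding spin2_coeff_def by (rule the1_equality[OF spin2_coeff_ex1])

lemma spin2_coeff_add: "spin2_coeff (X + Y) = (\<lambda>I J. spin2_coeff X I J + spin2_coeff Y I J)"
  by (rule spin2_coeff_eqI)
    (simp add: spin2_part_linear spin2_part_coeff[of X] spin2_part_coeff[of Y]
      gscale_simps sum.distrib)

lemma spin2_coeff_gscale: "spin2_coeff (c *\<^sub>G X) = (\<lambda>I J. c * spin2_coeff X I J)"
  by (rule spin2_coeff_eqI)
    (simp add: spin2_part_linear spin2_part_coeff[of X] gscale_simps gscale_sum)

text \<open>The component only sees the monomials on the sets \<open>spin2_set I J\<close>. If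
  \<open>X\<close> has a \<open>G\<close>-degree that none of these sets has, it contributes
  nothing. All unwanted terms below are discarded in this way, each time with a suitable
  \<open>G\<close>.\<close>

lemma spin2_coeff_eq_0:
  assumes "homog G n X" "\<And>I J. card (spin2_set I J \<inter> G) \<noteq> n"
  shows "spin2_coeff X = (\<lambda>I J. 0)"
proof (rule spin2_coeff_eqI)
  have "spin2_part X = 0"
    using assms by (intro grassmann_eqI)
      (auto simp: spin2_part.rep_eq zero_grassmann.rep_eq homog_def spin2_degree_iff)
  then show "spin2_part X = (\<Sum>I\<in>UNIV. \<Sum>J\<in>UNIV. 0 *\<^sub>G spin2_monom I J)"
    by (simp add: gscale_simps)
qed

text \<open>No monomial of the component contains an \<open>EtaP\<close>. Since
  \<open>kill_gens\<close> is multiplicative, each factor of the superamplitude can therefore be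
  simplified before any product is expanded.\<close>

lemma spin2_coeff_kill_etaP: "spin2_coeff (kill_gens (range EtaP) X) = spin2_coeff X"
proof -
  have "spin2_part (kill_gens (range EtaP) X) = spin2_part X"
  proof (rule grassmann_eqI)
    fix S
    have "S \<inter> range EtaP = {}" if "spin2_degree S"
      using that by (auto simp: spin2_degree_iff)
    then show "coeff (spin2_part (kill_gens (range EtaP) X)) S = coeff (spin2_part X) S"
      by (simp add: spin2_part.rep_eq kill_gens.rep_eq)
  qed
  then show ?thesis by (simp add: spin2_coeff_def)
qed


section \<open>Products of linear forms\<close>

definition leg_gens :: "2 \<Rightarrow> 4 \<Rightarrow> generator set" where
  "leg_gens i A = range (\<lambda>I. Eta i I A)"

definition flavour_gens :: "4 \<Rightarrow> generator set" where
  "flavour_gens A = leg_gens 1 A \<union> leg_gens 2 A"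

lemma card_spin2_set_leg: "card (spin2_set I J \<inter> leg_gens 1 A) = 1"
proof -
  have "spin2_set I J \<inter> leg_gens 1 A = {Eta 1 (I A) A}"
    by (auto simp: leg_gens_def)
  then show ?thesis by simp
qed

lemma card_spin2_set_flavour: "card (spin2_set I J \<inter> flavour_gens A) = 2"
proof -
  have "spin2_set I J \<inter> flavour_gens A = {Eta 1 (I A) A, Eta 2 (J A) A}"
    by (auto simp: leg_gens_def flavour_gens_def)
  then show ?thesis by simp
qed

definition leg_form :: "2 \<Rightarrow> (2 \<Rightarrow> complex) \<Rightarrow> 4 \<Rightarrow> generator grassmann" where
  "leg_form i a A = (\<Sum>I\<in>UNIV. a I *\<^sub>G eta i I A)"

definition linear_form :: "(2 \<Rightarrow> 2 \<Rightarrow> complex) \<Rightarrow> 4 \<Rightarrow> generator grassmann" where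
  "linear_form f A = (\<Sum>i\<in>UNIV. \<Sum>I\<in>UNIV. f i I *\<^sub>G eta i I A)"

definition pair_form :: "(2 \<Rightarrow> 2 \<Rightarrow> complex) \<Rightarrow> 4 \<Rightarrow> generator grassmann" where
  "pair_form c A = (\<Sum>I\<in>UNIV. \<Sum>J\<in>UNIV. c I J *\<^sub>G (eta 1 I A * eta 2 J A))"

text \<open>The 2 by 2 minor of the coefficient rows \<open>f\<close> and \<open>g\<close> in the
  columns (1, \<open>I\<close>) and (2, \<open>J\<close>). It is the coefficient of
  \<open>eta 1 I A * eta 2 J A\<close> in the product of the two linear forms, the minus sign coming
  from reordering.\<close>

definition minor2 :: "(2 \<Rightarrow> 2 \<Rightarrow> complex) \<Rightarrow> (2 \<Rightarrow> 2 \<Rightarrow> complex) \<Rightarrow> 2 \<Rightarrow> 2 \<Rightarrow> complex" where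
  "minor2 f g I J = f 1 I * g 2 J - f 2 J * g 1 I"

lemma kill_etaP_linear_form: "kill_gens (range EtaP) (linear_form f A) = linear_form f A"
  by (simp add: linear_form_def kill_gens_sum kill_gens_linear kill_gens_ggen image_iff)

lemma linear_form_anticomm:
  "linear_form f A * linear_form g B = - (linear_form g B * linear_form f A)"
proof -
  have *: "(c *\<^sub>G ggen p) * (d *\<^sub>G ggen q) = - ((d *\<^sub>G ggen q) * (c *\<^sub>G ggen p))"
    for c d and p q :: generator
    by (subst (1 2) gscale_simps(7), subst (1 2) gscale_simps(8), subst ggen_anticomm)
      (simp add: gscale_simps gscale_minus mult.commute)
  have exp: "linear_form h C = (\<Sum>(i, I)\<in>UNIV. h i I *\<^sub>G eta i I C)" for h C
    by (simp add: linear_form_def sum.cartesian_product UNIV_Times_UNIV)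
  have "linear_form f A * linear_form g B =
      (\<Sum>p\<in>UNIV. \<Sum>q\<in>UNIV. (f (fst p) (snd p) *\<^sub>G eta (fst p) (snd p) A)
        * (g (fst q) (snd q) *\<^sub>G eta (fst q) (snd q) B))"
    unfolding exp sum_product by (simp add: case_prod_beta)
  also have "\<dots> = - (\<Sum>p\<in>UNIV. \<Sum>q\<in>UNIV. (g (fst q) (snd q) *\<^sub>G eta (fst q) (snd q) B)
        * (f (fst p) (snd p) *\<^sub>G eta (fst p) (snd p) A))"
    by (subst *) (simp add: sum_negf)
  also have "\<dots> = - (linear_form g B * linear_form f A)"
    unfolding exp sum_product by (subst sum.swap) (simp add: case_prod_beta)
  finally show ?thesis .
qed

lemma homog_eta:
  "homog (leg_gens i B) (if i = j \<and> A = B then 1 else 0) (eta j I A)"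
  "homog (flavour_gens B) (if A = B then 1 else 0) (eta j I A)"
proof -
  have "Eta j I A \<in> leg_gens i B \<longleftrightarrow> i = j \<and> A = B" by (auto simp: leg_gens_def)
  then show "homog (leg_gens i B) (if i = j \<and> A = B then 1 else 0) (eta j I A)"
    using homog_ggen[of "leg_gens i B" "Eta j I A"] by simp
  have "Eta j I A \<in> flavour_gens B \<longleftrightarrow> A = B"
    using exhaust_2[of j] by (auto simp: leg_gens_def flavour_gens_def)
  then show "homog (flavour_gens B) (if A = B then 1 else 0) (eta j I A)"
    using homog_ggen[of "flavour_gens B" "Eta j I A"] by simp
qed

lemma homog_leg_form:
  "homog (leg_gens i B) (if i = j \<and> A = B then 1 else 0) (leg_form j a A)"
  unfolding leg_form_def by (intro homog_sum homog_gscale homog_eta)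

lemma homog_linear_form:
  "homog (flavour_gens B) (if A = B then 1 else 0) (linear_form f A)"
  unfolding linear_form_def by (intro homog_sum homog_gscale homog_eta)

lemma homog_leg_linear_form: "A \<noteq> B \<Longrightarrow> homog (leg_gens i B) 0 (linear_form f A)"
  unfolding linear_form_def
  by (intro homog_sum homog_gscale) (use homog_eta(1)[of i B _ A] in auto)

lemma homog_leg_pair_form: "A \<noteq> B \<Longrightarrow> homog (leg_gens i B) 0 (pair_form c A)"
  unfolding pair_form_def
  by (intro homog_sum homog_gscale homog_mult[where n = 0 and k = 0, simplified])
    (use homog_eta(1)[of i B _ A] in auto)

text \<open>Each form is split by legs. The two cross terms, written with leg 1 first, combine into
  the minors. The other two products are quadratic in a single leg and have no place in the
  component.\<close>

lemma linear_form_mult_eq: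
  "linear_form f A * linear_form g A = pair_form (minor2 f g) A
     + (leg_form 1 (f 1) A * leg_form 1 (g 1) A + leg_form 2 (f 2) A * leg_form 2 (g 2) A)"
proof -
  have "eta 2 I A * eta 1 J A = (-1) *\<^sub>G (eta 1 J A * eta 2 I A)" for I J
    by (subst ggen_anticomm) (simp add: gscale_minus gscale_simps)
  then have "leg_form 2 (f 2) A * leg_form 1 (g 1) A =
      (\<Sum>J\<in>UNIV. \<Sum>I\<in>UNIV. (- f 2 J * g 1 I) *\<^sub>G (eta 1 I A * eta 2 J A))"
    by (simp add: leg_form_def sum_product gscale_simps mult.commute)
  moreover have "leg_form 1 (f 1) A * leg_form 2 (g 2) A =
      (\<Sum>I\<in>UNIV. \<Sum>J\<in>UNIV. (f 1 I * g 2 J) *\<^sub>G (eta 1 I A * eta 2 J A))"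
    by (simp add: leg_form_def sum_product gscale_simps mult.commute)
  moreover have "pair_form (minor2 f g) A =
      (\<Sum>I\<in>UNIV. \<Sum>J\<in>UNIV. (f 1 I * g 2 J) *\<^sub>G (eta 1 I A * eta 2 J A))
      + (\<Sum>J\<in>UNIV. \<Sum>I\<in>UNIV. (- f 2 J * g 1 I) *\<^sub>G (eta 1 I A * eta 2 J A))"
    unfolding pair_form_def minor2_def
    by (subst (3) sum.swap) (simp add: sum.distrib[symmetric] gscale_simps(1)[symmetric])
  moreover have "linear_form h A = leg_form 1 (h 1) A + leg_form 2 (h 2) A" for h
    by (simp add: linear_form_def leg_form_def sum_2)
  ultimately show ?thesis by (simp add: algebra_simps)
qed

text \<open>The grading by leg 1 of flavour \<open>A\<close> removes both unwanted products at once: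
  they have degree 2 and 0, the component has degree 1, and the surroundings \<open>X\<close> and
  \<open>Y\<close> have degree 0.\<close>

lemma spin2_coeff_pair:
  assumes "homog (leg_gens 1 A) 0 X" "homog (leg_gens 1 A) 0 Y"
  shows "spin2_coeff (X * (linear_form f A * linear_form g A) * Y) =
         spin2_coeff (X * pair_form (minor2 f g) A * Y)"
proof -
  have "homog (leg_gens 1 A) (0 + (1 + 1) + 0) (X * (leg_form 1 (f 1) A * leg_form 1 (g 1) A) * Y)"
    by (intro homog_mult assms) (use homog_leg_form[of 1 A 1 A] in auto)
  then have 1: "spin2_coeff (X * (leg_form 1 (f 1) A * leg_form 1 (g 1) A) * Y) = (\<lambda>I J. 0)"
    by (rule spin2_coeff_eq_0) (simp add: card_spin2_set_leg)
  have "homog (leg_gens 1 A) (0 + (0 + 0) + 0) (X * (leg_form 2 (f 2) A * leg_form 2 (g 2) A) * Y)"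
    by (intro homog_mult assms) (use homog_leg_form[of 1 A 2 A] in auto)
  then have 2: "spin2_coeff (X * (leg_form 2 (f 2) A * leg_form 2 (g 2) A) * Y) = (\<lambda>I J. 0)"
    by (rule spin2_coeff_eq_0) (simp add: card_spin2_set_leg)
  show ?thesis
    unfolding linear_form_mult_eq distrib_left distrib_right spin2_coeff_add 1 2 by simp
qed

section \<open>The component of a product over all four flavours\<close>

definition tuple4 :: "'a \<Rightarrow> 'a \<Rightarrow> 'a \<Rightarrow> 'a \<Rightarrow> 4 \<Rightarrow> 'a" where
  "tuple4 p q r s k = (if k = 1 then p else if k = 2 then q else if k = 3 then r else s)"

lemma tuple4_simps [simp]:
  "tuple4 p q r s 1 = p" "tuple4 p q r s 2 = q" "tuple4 p q r s 3 = r" "tuple4 p q r s 4 = s"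
  by (simp_all add: tuple4_def)

lemma tuple4_eta: "tuple4 (f 1) (f 2) (f 3) (f 4) = f"
proof
  show "tuple4 (f 1) (f 2) (f 3) (f 4) k = f k" for k
    using exhaust_4[of k] by auto
qed

text \<open>Multiplying out the four pair forms yields the monomials \<open>spin2_monom I J\<close>
  with their factors already in the right order, so no sign arises and the coefficients can be read
  off.\<close>

lemma spin2_coeff_pair_forms:
  "spin2_coeff (pair_form c1 1 * pair_form c2 2 * pair_form c3 3 * pair_form c4 4) =
    (\<lambda>I J. c1 (I 1) (J 1) * c2 (I 2) (J 2) * c3 (I 3) (J 3) * c4 (I 4) (J 4))"
proof (rule spin2_coeff_eqI)
  define C where "C I J = c1 (I 1) (J 1) * c2 (I 2) (J 2) * c3 (I 3) (J 3) * c4 (I 4) (J 4)"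
    for I J :: "4 \<Rightarrow> 2"
  let ?X = "pair_form c1 1 * pair_form c2 2 * pair_form c3 3 * pair_form c4 4"
  have exp: "pair_form c A = (\<Sum>p\<in>UNIV. c (fst p) (snd p) *\<^sub>G (eta 1 (fst p) A * eta 2 (snd p) A))"
    for c A
    by (simp add: pair_form_def sum.cartesian_product UNIV_Times_UNIV case_prod_beta)
  let ?F = "\<lambda>p q r s. C (fst \<circ> tuple4 p q r s) (snd \<circ> tuple4 p q r s) *\<^sub>G
      spin2_monom (fst \<circ> tuple4 p q r s) (snd \<circ> tuple4 p q r s)"
  have "?X = (\<Sum>p\<in>UNIV. \<Sum>q\<in>UNIV. \<Sum>r\<in>UNIV. \<Sum>s\<in>UNIV. ?F p q r s)"
    unfolding mult.assoc unfolding exp unfolding sum_product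
    by (simp add: C_def spin2_monom_def gscale_sum sum_distrib_left gscale_simps mult_ac)
  also have "\<dots> = (\<Sum>(p, q, r, s)\<in>UNIV. ?F p q r s)"
    by (simp add: sum.cartesian_product UNIV_Times_UNIV)
  also have "\<dots> = (\<Sum>(I, J)\<in>UNIV. C I J *\<^sub>G spin2_monom I J)"
    \<comment> \<open>Four index pairs, one for each flavour, are the same data as two index
      functions on the four flavours.\<close>
    by (rule sum.reindex_bij_witness[where
          j = "\<lambda>(p, q, r, s). (fst \<circ> tuple4 p q r s, snd \<circ> tuple4 p q r s)" and
          i = "\<lambda>(I, J). ((I 1, J 1), (I 2, J 2), (I 3, J 3), (I 4, J 4))"])
      (auto simp: tuple4_eta[of "\<lambda>k. (_ k, _ k)", simplified] comp_def)
  also have "\<dots> = (\<Sum>I\<in>UNIV. \<Sum>J\<in>UNIV. C I J *\<^sub>G spin2_monom I J)"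
    by (simp add: sum.cartesian_product UNIV_Times_UNIV)
  finally have X: "?X = \<dots>" .
  \<comment> \<open>The monomials lie in the component themselves, so the projection leaves the
    expanded sum unchanged.\<close>
  have mon: "spin2_part (spin2_monom I J) = spin2_monom I J" for I J
  proof -
    obtain c where "spin2_monom I J = c *\<^sub>G gmonom (spin2_set I J)" using spin2_monom_eq by metis
    moreover have "spin2_degree (spin2_set I J)" using spin2_degree_iff by blast
    ultimately show ?thesis
      by (intro grassmann_eqI) (auto simp: spin2_part.rep_eq gscale.rep_eq gmonom.rep_eq)
  qed
  have "spin2_part 0 = 0"
    by (rule grassmann_eqI) (simp add: spin2_part.rep_eq zero_grassmann.rep_eq)
  then have sum: "spin2_part (sum f A) = (\<Sum>x\<in>A. spin2_part (f x))" for f and A :: "'z set"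
    by (induction A rule: infinite_finite_induct) (simp_all add: spin2_part_linear)
  show "spin2_part ?X = (\<Sum>I\<in>UNIV. \<Sum>J\<in>UNIV. (c1 (I 1) (J 1) * c2 (I 2) (J 2)
      * c3 (I 3) (J 3) * c4 (I 4) (J 4)) *\<^sub>G spin2_monom I J)"
    unfolding C_def[symmetric] X sum spin2_part_linear mon ..
qed

text \<open>Flavour by flavour, \<open>spin2_coeff_pair\<close> replaces a product of two linear
  forms by its pair form. The factors of other flavours have degree 0 in the leg concerned.\<close>

lemma spin2_coeff_linear_forms:
  "spin2_coeff ((linear_form f1 1 * linear_form g1 1) * (linear_form f2 2 * linear_form g2 2)
       * (linear_form f3 3 * linear_form g3 3) * (linear_form f4 4 * linear_form g4 4)) =
    (\<lambda>I J. minor2 f1 g1 (I 1) (J 1) * minor2 f2 g2 (I 2) (J 2)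
       * minor2 f3 g3 (I 3) (J 3) * minor2 f4 g4 (I 4) (J 4))"
proof -
  let ?l = "\<lambda>f g A. linear_form f A * linear_form g A"
  note h0 = homog_mult[where n = 0 and k = 0, simplified]
  have "spin2_coeff (?l f1 g1 1 * ?l f2 g2 2 * ?l f3 g3 3 * ?l f4 g4 4)
      = spin2_coeff (pair_form (minor2 f1 g1) 1 * ?l f2 g2 2 * ?l f3 g3 3 * ?l f4 g4 4)"
    \<comment> \<open>The first \<open>1\<close> is the flavour; the second is the unit of the
      algebra, standing for the empty left factor.\<close>
    using spin2_coeff_pair[of 1 1 "?l f2 g2 2 * ?l f3 g3 3 * ?l f4 g4 4" f1 g1]
    by (simp add: mult.assoc h0 homog_1 homog_leg_linear_form)
  also have "\<dots> = spin2_coeff (pair_form (minor2 f1 g1) 1 * pair_form (minor2 f2 g2) 2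
      * ?l f3 g3 3 * ?l f4 g4 4)"
    using spin2_coeff_pair[of 2 "pair_form (minor2 f1 g1) 1" "?l f3 g3 3 * ?l f4 g4 4" f2 g2]
    by (simp add: mult.assoc h0 homog_leg_linear_form homog_leg_pair_form)
  also have "\<dots> = spin2_coeff (pair_form (minor2 f1 g1) 1 * pair_form (minor2 f2 g2) 2
      * pair_form (minor2 f3 g3) 3 * ?l f4 g4 4)"
    using spin2_coeff_pair[of 3 "pair_form (minor2 f1 g1) 1 * pair_form (minor2 f2 g2) 2"
        "?l f4 g4 4" f3 g3]
    by (simp add: mult.assoc h0 homog_leg_linear_form homog_leg_pair_form)
  also have "\<dots> = spin2_coeff (pair_form (minor2 f1 g1) 1 * pair_form (minor2 f2 g2) 2
      * pair_form (minor2 f3 g3) 3 * pair_form (minor2 f4 g4) 4)"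
    using spin2_coeff_pair[of 4 "pair_form (minor2 f1 g1) 1 * pair_form (minor2 f2 g2) 2
        * pair_form (minor2 f3 g3) 3" 1 f4 g4]
    by (simp add: mult.assoc h0 homog_1 homog_leg_pair_form)
  finally show ?thesis by (simp only: spin2_coeff_pair_forms)
qed

text \<open>The result is grouped by degree. The first bracket has degree 2 in each of the flavours
  \<open>a\<close> and \<open>b\<close>, as the component requires; the second collects the terms of
  degree 3 and of degree 1 in each.\<close>

lemma kill_etaP_sector:
  fixes d h k :: "2 \<Rightarrow> 2 \<Rightarrow> complex" and \<theta> :: real
  defines "\<delta> \<equiv> linear_form d" and "H \<equiv> linear_form h" and "K \<equiv> linear_form k"
    and "c \<equiv> complex_of_real (cos \<theta>)" and "s \<equiv> complex_of_real (sin \<theta>)"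
  shows "kill_gens (range EtaP) (\<alpha> *\<^sub>G S1 \<delta> H K \<theta> a b + \<beta> *\<^sub>G S2 x \<delta> H K \<theta> a b) =
    (\<alpha> *\<^sub>G ((\<delta> a * H a) * (\<delta> b * H b))
      + (- (\<beta> * x * c * s)) *\<^sub>G ((\<delta> a * H a) * (\<delta> b * K b))
      + (- (\<beta> * x * c * s)) *\<^sub>G ((\<delta> a * K a) * (\<delta> b * H b)))
    + ((\<beta> * x * c * c) *\<^sub>G ((\<delta> a * H a * K b) * (\<delta> b * H b * K a))
      + (- (\<beta> * x * s * s)) *\<^sub>G (\<delta> a * \<delta> b))"
proof -
  have kill: "kill_gens (range EtaP) (\<delta> e) = \<delta> e" "kill_gens (range EtaP) (H e) = H e"
    "kill_gens (range EtaP) (K e) = K e" "kill_gens (range EtaP) (etaP e) = 0" for e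
    by (simp_all add: \<delta>_def H_def K_def kill_etaP_linear_form kill_gens_ggen)
  \<comment> \<open>Each factor of \<open>S1\<close> reduces to minus a product of
    \<open>\<delta>\<close> and \<open>H\<close>; the two signs cancel.\<close>
  have S1: "kill_gens (range EtaP) (S1 \<delta> H K \<theta> a b) = (\<delta> a * H a) * (\<delta> b * H b)"
    by (simp add: S1_def Let_def kill_gens_mult kill_gens_linear kill gscale_simps)
  \<comment> \<open>The mixed terms are sorted by flavour. Here \<open>K b\<close> passes one linear
    form and a sign arises; in the next fact \<open>K a\<close> passes two, and none does.\<close>
  have 1: "\<delta> a * H a * K b * \<delta> b = - ((\<delta> a * H a) * (\<delta> b * K b))"
    using linear_form_anticomm[of k b d b] by (simp add: K_def \<delta>_def mult.assoc)
  have "\<delta> b * (H b * K a) = K a * (\<delta> b * H b)"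
    using linear_form_anticomm[of h b k a] linear_form_anticomm[of d b k a]
    unfolding K_def \<delta>_def H_def by (simp add: mult.assoc[symmetric])
  then have 2: "\<delta> a * (\<delta> b * H b * K a) = (\<delta> a * K a) * (\<delta> b * H b)"
    by (simp add: mult.assoc)
  have "kill_gens (range EtaP) (S2 x \<delta> H K \<theta> a b) =
      (- x) *\<^sub>G ((c *\<^sub>G (\<delta> a * H a * (- K b)) + s *\<^sub>G \<delta> a) * (c *\<^sub>G (\<delta> b * H b * K a) + s *\<^sub>G \<delta> b))"
    by (simp add: S2_def Let_def kill_gens_mult kill_gens_linear kill c_def s_def)
  also have "\<dots> = (- x) *\<^sub>G (- ((c * c) *\<^sub>G ((\<delta> a * H a * K b) * (\<delta> b * H b * K a)))
      - (c * s) *\<^sub>G (\<delta> a * H a * K b * \<delta> b)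
      + (c * s) *\<^sub>G (\<delta> a * (\<delta> b * H b * K a)) + (s * s) *\<^sub>G (\<delta> a * \<delta> b))"
    by (simp add: distrib_left distrib_right gscale_simps gscale_minus left_diff_distrib gscale_diff mult_ac)
  finally have S2: "kill_gens (range EtaP) (S2 x \<delta> H K \<theta> a b) = \<dots>" .
  show ?thesis
    unfolding kill_gens_linear S1 S2 1 2
    by (simp add: gscale_simps gscale_minus gscale_diff mult.assoc)
qed

lemma homog_flavour_mult:
  assumes "homog (flavour_gens A) n X" "homog (flavour_gens A) k Y" "n + k \<noteq> 2"
  shows "spin2_coeff (X * Y) = (\<lambda>I J. 0)"
  by (rule spin2_coeff_eq_0[OF homog_mult[OF assms(1,2)]])
    (use assms(3) in \<open>simp add: card_spin2_set_flavour\<close>)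

text \<open>The second sector is free of flavour 1, so the terms of degree 3 or 1 in flavour 1
  cannot contribute; the same argument with flavour 3 then cleans the second sector. What is left,
  \<open>L * L'\<close>, is evaluated by minors.\<close>

lemma spin2_coeff_sectors:
  fixes d h k :: "2 \<Rightarrow> 2 \<Rightarrow> complex" and \<theta> \<phi> :: real and x \<alpha>1 \<alpha>2 \<alpha>3 \<alpha>4 :: complex
  defines "\<delta> \<equiv> linear_form d" and "H \<equiv> linear_form h" and "K \<equiv> linear_form k"
    and "t \<equiv> \<alpha>2 * x * complex_of_real (cos \<theta>) * complex_of_real (sin \<theta>)"
    and "t' \<equiv> \<alpha>4 * x * complex_of_real (cos \<phi>) * complex_of_real (sin \<phi>)"
  shows "spin2_coeff ((\<alpha>1 *\<^sub>G S1 \<delta> H K \<theta> 1 2 + \<alpha>2 *\<^sub>G S2 x \<delta> H K \<theta> 1 2)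
        * (\<alpha>3 *\<^sub>G S1 \<delta> H K \<phi> 3 4 + \<alpha>4 *\<^sub>G S2 x \<delta> H K \<phi> 3 4)) =
    (\<lambda>I J. let p = (\<lambda>A. minor2 d h (I A) (J A)); q = (\<lambda>A. minor2 d k (I A) (J A))
       in (\<alpha>1 * p 1 * p 2 - t * (p 1 * q 2 + q 1 * p 2))
        * (\<alpha>3 * p 3 * p 4 - t' * (p 3 * q 4 + q 3 * p 4)))"
    (is "spin2_coeff (?X * ?Y) = _")
proof -
  define L where "L = \<alpha>1 *\<^sub>G ((\<delta> 1 * H 1) * (\<delta> 2 * H 2))
    + (- t) *\<^sub>G ((\<delta> 1 * H 1) * (\<delta> 2 * K 2)) + (- t) *\<^sub>G ((\<delta> 1 * K 1) * (\<delta> 2 * H 2))"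
  define L' where "L' = \<alpha>3 *\<^sub>G ((\<delta> 3 * H 3) * (\<delta> 4 * H 4))
    + (- t') *\<^sub>G ((\<delta> 3 * H 3) * (\<delta> 4 * K 4)) + (- t') *\<^sub>G ((\<delta> 3 * K 3) * (\<delta> 4 * H 4))"
  let ?cub = "\<lambda>a b. \<delta> a * H a * K b * (\<delta> b * H b * K a)"
  have lf1: "homog (flavour_gens A) 1 (linear_form f A)" for f A
    using homog_linear_form[of A A f] by simp
  have lf0: "homog (flavour_gens A) 0 (linear_form f B)" if "B \<noteq> A" for f A B
    using homog_linear_form[of A B f] that by simp
  note mult0 = homog_mult[where n = 0 and k = 0, simplified]
  \<comment> \<open>The coefficients of the terms that drop out by degree are kept abstract.\<close>
  obtain c3 c1 where X: "kill_gens (range EtaP) ?X = L + (c3 *\<^sub>G ?cub 1 2 + c1 *\<^sub>G (\<delta> 1 * \<delta> 2))"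
    unfolding L_def t_def \<delta>_def H_def K_def kill_etaP_sector by blast
  obtain c3' c1' where Y: "kill_gens (range EtaP) ?Y = L' + (c3' *\<^sub>G ?cub 3 4 + c1' *\<^sub>G (\<delta> 3 * \<delta> 4))"
    unfolding L'_def t'_def \<delta>_def H_def K_def kill_etaP_sector by blast
  define Y where "Y = L' + (c3' *\<^sub>G ?cub 3 4 + c1' *\<^sub>G (\<delta> 3 * \<delta> 4))"
  have Y0: "homog (flavour_gens 1) 0 Y"
    unfolding Y_def L'_def \<delta>_def H_def K_def
    by (intro homog_add homog_gscale mult0 lf0) simp_all
  have L0: "homog (flavour_gens 3) 0 L"
    unfolding L_def \<delta>_def H_def K_def by (intro homog_add homog_gscale mult0 lf0) simp_all
  \<comment> \<open>The degree is written factor by factor to fit \<open>homog_mult\<close>; it adds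
    up to 3.\<close>
  have cub: "homog (flavour_gens a) (1 + 1 + 0 + (0 + 0 + 1)) (c *\<^sub>G ?cub a b)" if "b \<noteq> a" for a b c
    unfolding \<delta>_def H_def K_def by (intro homog_gscale homog_mult lf1 lf0) (use that in auto)
  have quad: "homog (flavour_gens a) (1 + 0) (c *\<^sub>G (\<delta> a * \<delta> b))" if "b \<noteq> a" for a b c
    unfolding \<delta>_def by (intro homog_gscale homog_mult lf1 lf0) (use that in auto)
  have zero: "spin2_coeff ((c3 *\<^sub>G ?cub 1 2) * Y) = (\<lambda>I J. 0)"
      "spin2_coeff ((c1 *\<^sub>G (\<delta> 1 * \<delta> 2)) * Y) = (\<lambda>I J. 0)"
      "spin2_coeff (L * (c3' *\<^sub>G ?cub 3 4)) = (\<lambda>I J. 0)"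
      "spin2_coeff (L * (c1' *\<^sub>G (\<delta> 3 * \<delta> 4))) = (\<lambda>I J. 0)"
    by (rule homog_flavour_mult[OF cub Y0] homog_flavour_mult[OF quad Y0]
        homog_flavour_mult[OF L0 cub] homog_flavour_mult[OF L0 quad]; simp)+
  have "spin2_coeff (?X * ?Y) =
      spin2_coeff ((L + (c3 *\<^sub>G ?cub 1 2 + c1 *\<^sub>G (\<delta> 1 * \<delta> 2))) * Y)"
    by (subst spin2_coeff_kill_etaP[symmetric]) (simp only: kill_gens_mult X Y Y_def)
  also have "\<dots> = spin2_coeff (L * Y)"
    by (simp only: distrib_right spin2_coeff_add zero add_0_right)
  also have "\<dots> = spin2_coeff (L * L')"
    by (simp only: Y_def distrib_left spin2_coeff_add zero add_0_right)
  also have "\<dots> = (\<lambda>I J. let p = (\<lambda>A. minor2 d h (I A) (J A)); q = (\<lambda>A. minor2 d k (I A) (J A))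
       in (\<alpha>1 * p 1 * p 2 - t * (p 1 * q 2 + q 1 * p 2))
        * (\<alpha>3 * p 3 * p 4 - t' * (p 3 * q 4 + q 3 * p 4)))"
    \<comment> \<open>Three terms in each sector give nine products. They and the formula for linear
      forms are brought to the same bracketing so that they match.\<close>
    unfolding L_def L'_def \<delta>_def H_def K_def distrib_left distrib_right gscale_simps(7,8)
      spin2_coeff_add spin2_coeff_gscale mult.assoc[symmetric, where 'a = "generator grassmann"]
    unfolding mult.assoc[where 'a = "generator grassmann"]
      spin2_coeff_linear_forms[unfolded mult.assoc[where 'a = "generator grassmann"]]
    by (simp add: Let_def fun_eq_iff) (simp add: algebra_simps)
  finally show ?thesis .
qed

section \<open>Kinematics\<close>

lemma angle_br_eq: "\<langle>u, v\<rangle> = u $ 2 * v $ 1 - u $ 1 * v $ 2"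
  by (simp add: angle_br_def raise_ix_def eps_up_def sum_2)

lemma square_br_eq: "\<lbrakk>u, v\<rbrakk>\<^sub>s = u $ 1 * v $ 2 - u $ 2 * v $ 1"
  by (simp add: square_br_def raise_ix_def eps_up_def sum_2)

text \<open>Multiplying by \<open>raise_ix w\<close> contracts the dotted index of the momentum, so
  this is the sandwich \<open><u|p|w]\<close>. The two terms are the two nonzero entries of
  \<open>eps_down\<close>.\<close>

lemma angle_massive_mom:
  "\<langle>u, massive_mom l lt *v raise_ix w\<rangle> = \<langle>u, l 2\<rangle> * \<lbrakk>lt 1, w\<rbrakk>\<^sub>s - \<langle>u, l 1\<rangle> * \<lbrakk>lt 2, w\<rbrakk>\<^sub>s"
  by (simp add: angle_br_eq square_br_eq massive_mom_def matrix_vector_mult_def raise_ix_def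
      eps_up_def eps_down_def sum_2) (simp add: algebra_simps)

lemma angle_massless_mom:
  "\<langle>u, massless_mom l lt *v raise_ix w\<rangle> = \<langle>u, l\<rangle> * \<lbrakk>lt, w\<rbrakk>\<^sub>s"
  by (simp add: angle_br_eq square_br_eq massless_mom_def matrix_vector_mult_def raise_ix_def
      eps_up_def sum_2) (simp add: algebra_simps)

lemma angle_br_linear:
  "\<langle>u, v + w\<rangle> = \<langle>u, v\<rangle> + \<langle>u, w\<rangle>" "\<langle>u, c *s v\<rangle> = c * \<langle>u, v\<rangle>" "\<langle>u, 0\<rangle> = 0"
  by (simp_all add: angle_br_eq algebra_simps)

lemma angle_br_swap: "\<langle>u, v\<rangle> = - \<langle>v, u\<rangle>"
  by (simp add: angle_br_eq)

text \<open>With \<open>z\<close> a reference spinor and \<open>p\<close> the massless one,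
  \<open>z\<close> survives only in its bracket with \<open>p\<close>, which is what the
  normalization of \<open>H\<close> divides by. The square bracket version serves the conjugate of
  \<open>H\<close> likewise.\<close>

lemma angle_br_schouten: "\<langle>p, u\<rangle> * \<langle>z, v\<rangle> - \<langle>p, v\<rangle> * \<langle>z, u\<rangle> = - \<langle>u, v\<rangle> * \<langle>z, p\<rangle>"
  by (simp add: angle_br_eq algebra_simps)

lemma square_br_schouten: "\<lbrakk>u, p\<rbrakk>\<^sub>s * \<lbrakk>z, v\<rbrakk>\<^sub>s - \<lbrakk>v, p\<rbrakk>\<^sub>s * \<lbrakk>z, u\<rbrakk>\<^sub>s = \<lbrakk>u, v\<rbrakk>\<^sub>s * \<lbrakk>z, p\<rbrakk>\<^sub>s"
  by (simp add: square_br_eq algebra_simps)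

text \<open>The Weyl equation of a massive leg: since \<open>l I\<close> has zero bracket with
  itself, one of the two terms survives. The next lemma is the counterpart on the dotted
  side.\<close>

lemma angle_massive_mom_self:
  assumes "\<And>I J. \<langle>l I, l J\<rangle> = - m * eps_up I J"
  shows "\<langle>l I, massive_mom l lt *v raise_ix w\<rangle> = - m * \<lbrakk>lt I, w\<rbrakk>\<^sub>s"
  using exhaust_2[of I] by (auto simp: angle_massive_mom assms eps_up_def)

lemma angle_massive_mom_square:
  assumes "\<And>I J. \<lbrakk>lt I, lt J\<rbrakk>\<^sub>s = m * eps_up I J"
  shows "\<langle>u, massive_mom l lt *v raise_ix (lt J)\<rangle> = m * \<langle>u, l J\<rangle>"
  using exhaust_2[of J] by (auto simp: angle_massive_mom assms eps_up_def)

text \<open>Bracketing the definition of \<open>x\<close> with \<open>u\<close> gives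
  \<open><u|p1|P] = m x <uP>\<close>. Momentum conservation and \<open>[PP] = 0\<close> give the
  opposite value for \<open>p2\<close>, and the Weyl equation turns both into square brackets. The
  relative sign of the legs is the reason for the signs \<open>\<sigma>\<close> in the conjugate of
  \<open>H\<close>.\<close>

lemma massless_square_proportional:
  fixes l lt :: "2 \<Rightarrow> 2 \<Rightarrow> complex^2"
  assumes "m \<noteq> 0"
    and l: "\<And>i I J. \<langle>l i I, l i J\<rangle> = - m * eps_up I J"
    and mom: "massive_mom (l 1) (lt 1) + massive_mom (l 2) (lt 2) + massless_mom lP ltP = 0"
    and x: "x *s lP = (1 / m) *s (massive_mom (l 1) (lt 1) *v raise_ix ltP)"
  shows "\<lbrakk>lt 1 I, ltP\<rbrakk>\<^sub>s = - x * \<langle>l 1 I, lP\<rangle>" and "\<lbrakk>lt 2 I, ltP\<rbrakk>\<^sub>s = x * \<langle>l 2 I, lP\<rangle>"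
proof -
  have p1: "\<langle>u, massive_mom (l 1) (lt 1) *v raise_ix ltP\<rangle> = m * (x * \<langle>u, lP\<rangle>)" for u
    using arg_cong[OF x, of "\<lambda>v. \<langle>u, v\<rangle>"] \<open>m \<noteq> 0\<close> by (simp add: angle_br_linear field_simps)
  have "\<lbrakk>ltP, ltP\<rbrakk>\<^sub>s = 0" by (simp add: square_br_eq)
  then have p2: "\<langle>u, massive_mom (l 2) (lt 2) *v raise_ix ltP\<rangle> = - m * (x * \<langle>u, lP\<rangle>)" for u
    using arg_cong[OF mom, of "\<lambda>p. \<langle>u, p *v raise_ix ltP\<rangle>"]
    by (simp add: matrix_vector_mult_add_rdistrib angle_br_linear angle_massless_mom p1
        add_eq_0_iff2)
  show "\<lbrakk>lt 1 I, ltP\<rbrakk>\<^sub>s = - x * \<langle>l 1 I, lP\<rangle>"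
  proof -
    have "(- m) * \<lbrakk>lt 1 I, ltP\<rbrakk>\<^sub>s = (- m) * (- x * \<langle>l 1 I, lP\<rangle>)"
      using p1[of "l 1 I"] unfolding angle_massive_mom_self[of "l 1", OF l] by simp
    then show ?thesis using \<open>m \<noteq> 0\<close> by (simp only: mult_left_cancel neg_equal_0_iff_equal simp_thms)
  qed
  show "\<lbrakk>lt 2 I, ltP\<rbrakk>\<^sub>s = x * \<langle>l 2 I, lP\<rangle>"
    using p2[of "l 2 I"] \<open>m \<noteq> 0\<close> unfolding angle_massive_mom_self[of "l 2", OF l] by simp
qed

text \<open>Momentum conservation is sandwiched between the undotted spinor of leg 1 and the dotted
  spinor of leg 2: \<open>p1\<close> acts to the left and \<open>p2\<close> to the right by the Weyl
  equations, while the massless momentum factorizes.\<close>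

lemma square_br_massive:
  fixes l lt :: "2 \<Rightarrow> 2 \<Rightarrow> complex^2"
  assumes "m \<noteq> 0"
    and l: "\<And>i I J. \<langle>l i I, l i J\<rangle> = - m * eps_up I J"
    and lt: "\<And>i I J. \<lbrakk>lt i I, lt i J\<rbrakk>\<^sub>s = m * eps_up I J"
    and mom: "massive_mom (l 1) (lt 1) + massive_mom (l 2) (lt 2) + massless_mom lP ltP = 0"
  shows "\<lbrakk>lt 1 I, lt 2 J\<rbrakk>\<^sub>s = \<langle>l 1 I, l 2 J\<rangle> + \<langle>l 1 I, lP\<rangle> * \<lbrakk>ltP, lt 2 J\<rbrakk>\<^sub>s / m"
proof -
  have "- m * \<lbrakk>lt 1 I, lt 2 J\<rbrakk>\<^sub>s + m * \<langle>l 1 I, l 2 J\<rangle> + \<langle>l 1 I, lP\<rangle> * \<lbrakk>ltP, lt 2 J\<rbrakk>\<^sub>s = 0"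
    using arg_cong[OF mom, of "\<lambda>p. \<langle>l 1 I, p *v raise_ix (lt 2 J)\<rangle>"]
    by (simp add: matrix_vector_mult_add_rdistrib angle_br_linear angle_massless_mom
        angle_massive_mom_self[of "l 1", OF l] angle_massive_mom_square[of "lt 2", OF lt])
  then show ?thesis using \<open>m \<noteq> 0\<close> by (simp add: field_simps)
qed


section \<open>Symmetrization\<close>

lemma symmetrize_add:
  "symmetrize (\<lambda>I J. C I J + D I J) I J = symmetrize C I J + symmetrize D I J"
  by (simp add: symmetrize_def sum.distrib add_divide_distrib)

lemma symmetrize_scale: "symmetrize (\<lambda>I J. c * C I J) I J = c * symmetrize C I J"
  by (simp add: symmetrize_def sum_distrib_left)

text \<open>Composition with \<open>\<tau>\<close> merely permutes the terms of each of the two sums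
  over permutations.\<close>

lemma symmetrize_permute:
  assumes "\<tau> permutes UNIV"
  shows "symmetrize (\<lambda>I J. C (I \<circ> \<tau>) (J \<circ> \<tau>)) = symmetrize C"
proof (intro ext)
  fix I J :: "4 \<Rightarrow> 2"
  have "(\<Sum>\<pi> | \<pi> permutes UNIV. \<Sum>\<rho> | \<rho> permutes UNIV. C (I \<circ> \<pi>) (J \<circ> \<rho>)) =
      (\<Sum>\<pi> | \<pi> permutes UNIV. \<Sum>\<rho> | \<rho> permutes UNIV. C (I \<circ> (\<pi> \<circ> \<tau>)) (J \<circ> (\<rho> \<circ> \<tau>)))"
    by (subst sum_permutations_compose_right[OF assms], subst sum_permutations_compose_right[OF assms])
      (rule refl)
  then show "symmetrize (\<lambda>I J. C (I \<circ> \<tau>) (J \<circ> \<tau>)) I J = symmetrize C I J"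
    by (simp add: symmetrize_def comp_assoc)
qed

definition index_product ::
  "(2 \<Rightarrow> 2 \<Rightarrow> complex) \<Rightarrow> (2 \<Rightarrow> 2 \<Rightarrow> complex) \<Rightarrow> (2 \<Rightarrow> 2 \<Rightarrow> complex) \<Rightarrow> (2 \<Rightarrow> 2 \<Rightarrow> complex) \<Rightarrow>
    (4 \<Rightarrow> 2) \<Rightarrow> (4 \<Rightarrow> 2) \<Rightarrow> complex" where
  "index_product c1 c2 c3 c4 I J = c1 (I 1) (J 1) * c2 (I 2) (J 2) * c3 (I 3) (J 3) * c4 (I 4) (J 4)"

text \<open>After symmetrization only the number of factors \<open>v\<close> matters. Each case
  exchanges two index pairs by a single transposition.\<close>

lemma symmetrize_index_product:
  "symmetrize (index_product u u v u) = symmetrize (index_product u u u v)"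
  "symmetrize (index_product u v u u) = symmetrize (index_product u u u v)"
  "symmetrize (index_product v u u u) = symmetrize (index_product u u u v)"
  "symmetrize (index_product u v u v) = symmetrize (index_product u u v v)"
  "symmetrize (index_product v u u v) = symmetrize (index_product u u v v)"
  "symmetrize (index_product u v v u) = symmetrize (index_product u u v v)"
  "symmetrize (index_product v u v u) = symmetrize (index_product u u v v)"
proof -
  have *: "symmetrize C = symmetrize D"
    if "\<And>I J. C I J = D (I \<circ> Transposition.transpose a b) (J \<circ> Transposition.transpose a b)" for C D and a b :: 4
    using symmetrize_permute[OF permutes_swap_id[of a UNIV b], of D] by (simp add: that[abs_def])
  show "symmetrize (index_product u u v u) = symmetrize (index_product u u u v)"
    by (rule *[of _ _ 3 4]) (simp add: index_product_def)
  show "symmetrize (index_product u v u u) = symmetrize (index_product u u u v)"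
    by (rule *[of _ _ 2 4]) (simp add: index_product_def)
  show "symmetrize (index_product v u u u) = symmetrize (index_product u u u v)"
    by (rule *[of _ _ 1 4]) (simp add: index_product_def)
  show "symmetrize (index_product u v u v) = symmetrize (index_product u u v v)"
    by (rule *[of _ _ 2 3]) (simp add: index_product_def)
  show "symmetrize (index_product v u u v) = symmetrize (index_product u u v v)"
    by (rule *[of _ _ 1 3]) (simp add: index_product_def)
  show "symmetrize (index_product u v v u) = symmetrize (index_product u u v v)"
    by (rule *[of _ _ 2 4]) (simp add: index_product_def)
  show "symmetrize (index_product v u v u) = symmetrize (index_product u u v v)"
    by (rule *[of _ _ 1 4]) (simp add: index_product_def)
qed

section \<open>The amplitude\<close>

theorem mainTheorem4:
  fixes m :: real and x :: complex
    and l lt :: "2 \<Rightarrow> 2 \<Rightarrow> complex^2"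
    and lP ltP \<zeta> \<xi> :: "complex^2"
    and \<delta> H Hbar :: "4 \<Rightarrow> generator grassmann"
    and \<sigma> :: "2 \<Rightarrow> complex"
    and Z12 Z34 \<theta>12 \<theta>34 :: real
    and \<kappa> \<alpha>1 \<alpha>2 \<alpha>3 \<alpha>4 :: complex
    and M :: "generator grassmann"
    and I J :: "4 \<Rightarrow> 2"
  assumes "m > 0"
    and "\<And>i I J. \<langle>l i I, l i J\<rangle> = - of_real m * eps_up I J"
    and "\<And>i I J. \<lbrakk>lt i I, lt i J\<rbrakk>\<^sub>s = of_real m * eps_up I J"
    and "lP \<noteq> 0" and "ltP \<noteq> 0"
    and "massive_mom (l 1) (lt 1) + massive_mom (l 2) (lt 2) + massless_mom lP ltP = 0"
    and "x \<noteq> 0"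
    and "x *s lP = (1 / of_real m) *s (massive_mom (l 1) (lt 1) *v raise_ix ltP)"
    and "\<langle>\<zeta>, lP\<rangle> \<noteq> 0" and "\<lbrakk>\<xi>, ltP\<rbrakk>\<^sub>s \<noteq> 0"
    and "\<sigma> 1 = 1" and "\<sigma> 2 = -1"
    and "\<And>A. \<delta> A = (\<Sum>i\<in>UNIV. \<Sum>I\<in>UNIV. \<langle>lP, l i I\<rangle> *\<^sub>G eta i I A)"
    and "\<And>A. H A = (1 / \<langle>\<zeta>, lP\<rangle>) *\<^sub>G (\<Sum>i\<in>UNIV. \<Sum>I\<in>UNIV. \<langle>\<zeta>, l i I\<rangle> *\<^sub>G eta i I A)"
    and "\<And>A. Hbar A =
           (1 / \<lbrakk>\<xi>, ltP\<rbrakk>\<^sub>s) *\<^sub>G (\<Sum>i\<in>UNIV. \<Sum>I\<in>UNIV. (\<lbrakk>\<xi>, lt i I\<rbrakk>\<^sub>s * \<sigma> i) *\<^sub>G eta i I A)"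
    and "\<bar>Z12\<bar> < 2 * m" and "\<bar>Z34\<bar> < 2 * m"
    and "\<theta>12 \<in> {- (pi / 4)<..<pi / 4}" and "\<theta>34 \<in> {- (pi / 4)<..<pi / 4}"
    and "sin (2 * \<theta>12) = Z12 / (2 * m)" and "sin (2 * \<theta>34) = Z34 / (2 * m)"
    and "\<alpha>1 * \<alpha>3 \<noteq> 0"
    and "M = (\<kappa> / (2 * of_real m ^ 2) * x\<^sup>2) *\<^sub>G
           ((\<alpha>1 *\<^sub>G S1 \<delta> H Hbar \<theta>12 1 2 + \<alpha>2 *\<^sub>G S2 x \<delta> H Hbar \<theta>12 1 2)
            * (\<alpha>3 *\<^sub>G S1 \<delta> H Hbar \<theta>34 3 4 + \<alpha>4 *\<^sub>G S2 x \<delta> H Hbar \<theta>34 3 4))"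
  shows
    "let
       g0 = \<alpha>1 * \<alpha>3 * (1 - \<alpha>2 / \<alpha>1 * (of_real Z12 / (2 * of_real m)))
              * (1 - \<alpha>4 / \<alpha>3 * (of_real Z34 / (2 * of_real m)));
       g1 = \<alpha>2 * \<alpha>4 * (of_real Z12 * of_real Z34 / (2 * of_real m ^ 2))
              - \<alpha>2 * \<alpha>3 * (of_real Z12 / (2 * of_real m))
              - \<alpha>1 * \<alpha>4 * (of_real Z34 / (2 * of_real m));
       g2 = \<alpha>2 * \<alpha>4 * (of_real Z12 * of_real Z34 / (4 * of_real m ^ 2));
       ang = (\<lambda>I J. \<langle>l 1 I, l 2 J\<rangle>);
       mix = (\<lambda>I J. \<langle>l 1 I, lP\<rangle> * \<lbrakk>ltP, lt 2 J\<rbrakk>\<^sub>s)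
     in spin2_amplitude M I J =
        \<kappa> / (2 * of_real m ^ 2) *
        (g0 * x\<^sup>2 * symmetrize (\<lambda>I J. \<Prod>k\<in>{1, 2, 3, 4}. ang (I k) (J k)) I J
         + g1 * x\<^sup>2 * symmetrize (\<lambda>I J. (\<Prod>k\<in>{1, 2, 3}. ang (I k) (J k))
             * (mix (I 4) (J 4) / of_real m)) I J
         + g2 * x\<^sup>2 * symmetrize (\<lambda>I J. (\<Prod>k\<in>{1, 2}. ang (I k) (J k))
             * (\<Prod>k\<in>{3, 4}. mix (I k) (J k) / of_real m)) I J)"
proof -
  define mc where "mc = complex_of_real m"
  have m: "mc \<noteq> 0" using assms(1) by (simp add: mc_def)
  define d where "d i I = \<langle>lP, l i I\<rangle>" for i I
  define h where "h i I = 1 / \<langle>\<zeta>, lP\<rangle> * \<langle>\<zeta>, l i I\<rangle>" for i I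
  define k where "k i I = 1 / \<lbrakk>\<xi>, ltP\<rbrakk>\<^sub>s * (\<lbrakk>\<xi>, lt i I\<rbrakk>\<^sub>s * \<sigma> i)" for i I
  have forms: "\<delta> = linear_form d" "H = linear_form h" "Hbar = linear_form k"
    by (simp_all add: fun_eq_iff linear_form_def d_def h_def k_def assms(13-15)
        gscale_sum gscale_simps)
  define u where "u I J = \<langle>l 1 I, l 2 J\<rangle>" for I J
  define v where "v I J = \<langle>l 1 I, lP\<rangle> * \<lbrakk>ltP, lt 2 J\<rbrakk>\<^sub>s / mc" for I J
  have dh: "minor2 d h I J = - u I J" for I J
    using angle_br_schouten[of lP "l 1 I" \<zeta> "l 2 J"] \<open>\<langle>\<zeta>, lP\<rangle> \<noteq> 0\<close>
    by (simp add: minor2_def d_def h_def u_def field_simps)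
  \<comment> \<open>The factor \<open>x\<close> comes from \<open>S2\<close>, whose mixed terms
    contain exactly one conjugate form each. It turns the angle brackets with the massless spinor
    into square brackets, and the opposite signs of the two legs are compensated by
    \<open>\<sigma>\<close>, so that the Schouten identity applies.\<close>
  have dk: "x * minor2 d k I J = - (u I J + v I J)" for I J
  proof -
    note ratio = massless_square_proportional[OF m assms(2)[folded mc_def] assms(6) assms(8)[folded mc_def]]
    have "x * d 1 I = \<lbrakk>lt 1 I, ltP\<rbrakk>\<^sub>s" "x * d 2 J = - \<lbrakk>lt 2 J, ltP\<rbrakk>\<^sub>s"
      unfolding ratio d_def by (subst angle_br_swap, simp)+
    then have "x * minor2 d k I J = - ((\<lbrakk>lt 1 I, ltP\<rbrakk>\<^sub>s * \<lbrakk>\<xi>, lt 2 J\<rbrakk>\<^sub>s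
        - \<lbrakk>lt 2 J, ltP\<rbrakk>\<^sub>s * \<lbrakk>\<xi>, lt 1 I\<rbrakk>\<^sub>s) / \<lbrakk>\<xi>, ltP\<rbrakk>\<^sub>s)"
      by (simp add: minor2_def k_def right_diff_distrib mult.assoc[symmetric]
          \<open>\<sigma> 1 = 1\<close> \<open>\<sigma> 2 = -1\<close> diff_divide_distrib)
    also have "\<dots> = - \<lbrakk>lt 1 I, lt 2 J\<rbrakk>\<^sub>s"
      unfolding square_br_schouten using \<open>\<lbrakk>\<xi>, ltP\<rbrakk>\<^sub>s \<noteq> 0\<close> by simp
    finally show ?thesis
      using square_br_massive[OF m assms(2)[folded mc_def] assms(3)[folded mc_def] assms(6), of I J]
      by (simp add: u_def v_def)
  qed
  have t: "complex_of_real (cos \<theta>) * complex_of_real (sin \<theta>) = of_real Z / (4 * mc)"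
    if "sin (2 * \<theta>) = Z / (2 * m)" for \<theta> Z
  proof -
    have "cos \<theta> * sin \<theta> = Z / (4 * m)" using that assms(1) unfolding sin_double by (simp add: field_simps)
    then have "complex_of_real (cos \<theta> * sin \<theta>) = of_real (Z / (4 * m))" by simp
    then show ?thesis by (simp add: mc_def)
  qed
  \<comment> \<open>With these abbreviations the claimed coefficients become
    \<open>(\<alpha>1 - z1) * (\<alpha>3 - z2)\<close>,
    \<open>- ((\<alpha>1 - z1) * z2 + (\<alpha>3 - z2) * z1)\<close> and
    \<open>z1 * z2\<close>.\<close>
  define z1 where "z1 = \<alpha>2 * of_real Z12 / (2 * mc)"
  define z2 where "z2 = \<alpha>4 * of_real Z34 / (2 * mc)"
  define U where "U I J A = u (I A) (J A)" for I J and A :: 4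
  define V where "V I J A = v (I A) (J A)" for I J and A :: 4
  define pre where "pre = \<kappa> / (2 * of_real m ^ 2)"
  \<comment> \<open>One sector in plain numbers: \<open>a\<close>, \<open>b\<close> stand for values
    of \<open>u\<close> and \<open>a'\<close>, \<open>b'\<close> for values of \<open>v\<close>,
    while \<open>qa\<close>, \<open>qb\<close> are the minors with the conjugate form.\<close>
  have sector: "\<alpha> * (- a) * (- b) - \<beta> * x * c * s * ((- a) * qb + qa * (- b))
      = \<alpha> * a * b - \<beta> * z / (4 * mc) * (2 * (a * b) + a * b' + a' * b)"
    if "c * s = z / (4 * mc)" "x * qa = - (a + a')" "x * qb = - (b + b')"
    for \<alpha> \<beta> c s z a b a' b' qa qb :: complex
  proof -
    have "\<beta> * x * c * s * ((- a) * qb + qa * (- b))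
        = \<beta> * (c * s) * ((- a) * (x * qb) + (x * qa) * (- b))"
      by (simp add: algebra_simps)
    also have "\<dots> = \<beta> * z / (4 * mc) * (2 * (a * b) + a * b' + a' * b)"
      unfolding that by (simp add: algebra_simps)
    finally show ?thesis by simp
  qed
  have coeff: "spin2_coeff M = (\<lambda>I J. pre * x\<^sup>2 *
      ((\<alpha>1 * U I J 1 * U I J 2
        - z1 / 2 * (2 * (U I J 1 * U I J 2) + U I J 1 * V I J 2 + V I J 1 * U I J 2))
     * (\<alpha>3 * U I J 3 * U I J 4
        - z2 / 2 * (2 * (U I J 3 * U I J 4) + U I J 3 * V I J 4 + V I J 3 * U I J 4))))"
    unfolding assms(23) forms spin2_coeff_gscale spin2_coeff_sectors Let_def
    using sector[OF t[OF assms(20)] dk dk] sector[OF t[OF assms(21)] dk dk]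
    by (simp add: dh U_def V_def z1_def z2_def pre_def)
  let ?T = "index_product"
  \<comment> \<open>Each sector is a multiple of \<open>u u\<close> minus half of \<open>z1\<close>
    or \<open>z2\<close> times \<open>u v + v u\<close>. It never contains two factors
    \<open>v\<close>, so the product stops at second order in \<open>v\<close>.\<close>
  have "spin2_coeff M = (\<lambda>I J.
      pre * x\<^sup>2 * (\<alpha>1 - z1) * (\<alpha>3 - z2) * ?T u u u u I J
      + (- (pre * x\<^sup>2 * (\<alpha>1 - z1) * z2 / 2) * ?T u u u v I J
      + (- (pre * x\<^sup>2 * (\<alpha>1 - z1) * z2 / 2) * ?T u u v u I J
      + (- (pre * x\<^sup>2 * (\<alpha>3 - z2) * z1 / 2) * ?T u v u u I J
      + (- (pre * x\<^sup>2 * (\<alpha>3 - z2) * z1 / 2) * ?T v u u u I J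
      + (pre * x\<^sup>2 * z1 * z2 / 4 * ?T u v u v I J
      + (pre * x\<^sup>2 * z1 * z2 / 4 * ?T u v v u I J
      + (pre * x\<^sup>2 * z1 * z2 / 4 * ?T v u u v I J
      + pre * x\<^sup>2 * z1 * z2 / 4 * ?T v u v u I J))))))))"
    unfolding coeff by (intro ext) (simp add: index_product_def U_def V_def field_simps)
  \<comment> \<open>Symmetrization identifies the two halves in each sector, and the four quarters
    of second order add up to \<open>z1 * z2\<close>.\<close>
  then have amp: "spin2_amplitude M I J = pre *
      ((\<alpha>1 - z1) * (\<alpha>3 - z2) * x\<^sup>2 * symmetrize (?T u u u u) I J
      + - ((\<alpha>1 - z1) * z2 + (\<alpha>3 - z2) * z1) * x\<^sup>2 * symmetrize (?T u u u v) I J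
      + z1 * z2 * x\<^sup>2 * symmetrize (?T u u v v) I J)"
    unfolding spin2_amplitude_def
    by (simp only: symmetrize_add symmetrize_scale symmetrize_index_product)
      (simp add: field_simps)
  have T0: "(\<lambda>I J. \<Prod>k\<in>{1, 2, 3, 4::4}. \<langle>l 1 (I k), l 2 (J k)\<rangle>) = ?T u u u u"
    by (simp add: index_product_def u_def fun_eq_iff)
  have T1: "(\<lambda>I J. (\<Prod>k\<in>{1, 2, 3::4}. \<langle>l 1 (I k), l 2 (J k)\<rangle>)
      * (\<langle>l 1 (I 4), lP\<rangle> * \<lbrakk>ltP, lt 2 (J 4)\<rbrakk>\<^sub>s / complex_of_real m)) = ?T u u u v"
    by (simp add: index_product_def u_def v_def mc_def fun_eq_iff)
  have T2: "(\<lambda>I J. (\<Prod>k\<in>{1, 2::4}. \<langle>l 1 (I k), l 2 (J k)\<rangle>)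
      * (\<Prod>k\<in>{3, 4}. \<langle>l 1 (I k), lP\<rangle> * \<lbrakk>ltP, lt 2 (J k)\<rbrakk>\<^sub>s / complex_of_real m)) = ?T u u v v"
    by (simp add: index_product_def u_def v_def mc_def fun_eq_iff)
  have "\<alpha>1 \<noteq> 0" "\<alpha>3 \<noteq> 0" using \<open>\<alpha>1 * \<alpha>3 \<noteq> 0\<close> by auto
  then have g0: "\<alpha>1 * \<alpha>3 * (1 - \<alpha>2 / \<alpha>1 * (of_real Z12 / (2 * of_real m)))
      * (1 - \<alpha>4 / \<alpha>3 * (of_real Z34 / (2 * of_real m))) = (\<alpha>1 - z1) * (\<alpha>3 - z2)"
    using m by (simp add: z1_def z2_def mc_def[symmetric] field_simps)
  have g1: "\<alpha>2 * \<alpha>4 * (of_real Z12 * of_real Z34 / (2 * of_real m ^ 2))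
      - \<alpha>2 * \<alpha>3 * (of_real Z12 / (2 * of_real m)) - \<alpha>1 * \<alpha>4 * (of_real Z34 / (2 * of_real m))
      = - ((\<alpha>1 - z1) * z2 + (\<alpha>3 - z2) * z1)"
    using m by (simp add: z1_def z2_def mc_def[symmetric] field_simps power2_eq_square)
  have g2: "\<alpha>2 * \<alpha>4 * (of_real Z12 * of_real Z34 / (4 * of_real m ^ 2)) = z1 * z2"
    using m by (simp add: z1_def z2_def mc_def[symmetric] field_simps power2_eq_square)
  show ?thesis
    by (simp only: Let_def amp T0 T1 T2 g0 g1 g2 pre_def)
qed

end
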